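(* Let $X=\prod_{i\in\mathbb{N}}(S^1\vee S^1)$ with the product topology, let $w_0$ be the wedge point of $S^1\vee S^1$, and let $x_0=(w_0,w_0,w_0,\dots)\in X$. Then $W=\pi_1^{wh}(X,x_0)$ is a non-abelian, Hausdorff, non-discrete topological group.
   Context: For a based space $(X,x_0)$, $\pi_1^{wh}(X,x_0)$ denotes the fundamental group $\pi_1(X,x_0)$ with the whisker topology: the topology having as a basis the sets $B([\zeta],U)=\{[\zeta\cdot\eta] : \eta \text{ a loop based at } x_0 \text{ with image contained in } U\}$, where $[\zeta]\in\pi_1(X,x_0)$ and $U$ is an open neighborhood of $x_0$ in $X$. Here $\zeta\cdot\eta$ is path concatenation. The product in the fundamental group is $[\zeta][\eta]=[\zeta\cdot\eta]$. *)

theory Defs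
  imports "HOL-Analysis.Analysis" "HOL-Algebra.Group"
begin

definition loop_at :: "'a topology \<Rightarrow> 'a \<Rightarrow> (real \<Rightarrow> 'a) \<Rightarrow> bool" where
  "loop_at X x0 p \<longleftrightarrow> pathin X p \<and> p 0 = x0 \<and> p 1 = x0"

definition loop_homotopic :: "'a topology \<Rightarrow> 'a \<Rightarrow> (real \<Rightarrow> 'a) \<Rightarrow> (real \<Rightarrow> 'a) \<Rightarrow> bool" where
  "loop_homotopic X x0 = homotopic_with (\<lambda>r. r 0 = x0 \<and> r 1 = x0) (top_of_set {0..1}) X"

text \<open>The library's \<^const>\<open>joinpaths\<close> needs its points to form a type of class
  \<^class>\<open>topological_space\<close>; this is the same formula without that constraint.\<close>

definition concat_paths :: "(real \<Rightarrow> 'a) \<Rightarrow> (real \<Rightarrow> 'a) \<Rightarrow> real \<Rightarrow> 'a" where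
  "concat_paths p q = (\<lambda>t. if t \<le> 1/2 then p (2 * t) else q (2 * t - 1))"

definition loop_class :: "'a topology \<Rightarrow> 'a \<Rightarrow> (real \<Rightarrow> 'a) \<Rightarrow> (real \<Rightarrow> 'a) set" where
  "loop_class X x0 p = {r. loop_homotopic X x0 p r}"

text \<open>The product is written as the set of all loops homotopic to a concatenation of
  representatives; \<open>mult_loop_class\<close> below shows that it is the class of the concatenation
  of any two representatives.\<close>

definition fundamental_group :: "'a topology \<Rightarrow> 'a \<Rightarrow> (real \<Rightarrow> 'a) set monoid" where
  "fundamental_group X x0 =
    \<lparr>carrier = {loop_class X x0 p |p. loop_at X x0 p},
     mult = (\<lambda>A B. \<Union>p\<in>A. \<Union>q\<in>B. loop_class X x0 (concat_paths p q)),
     one = loop_class X x0 (\<lambda>_. x0)\<rparr>"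

definition whisker_nbhd :: "'a topology \<Rightarrow> 'a \<Rightarrow> (real \<Rightarrow> 'a) \<Rightarrow> 'a set \<Rightarrow> (real \<Rightarrow> 'a) set set" where
  "whisker_nbhd X x0 \<zeta> U =
    {loop_class X x0 (concat_paths \<zeta> \<eta>) |\<eta>. loop_at X x0 \<eta> \<and> \<eta> ` {0..1} \<subseteq> U}"

definition whisker_basis :: "'a topology \<Rightarrow> 'a \<Rightarrow> (real \<Rightarrow> 'a) set set set" where
  "whisker_basis X x0 =
    {whisker_nbhd X x0 \<zeta> U |\<zeta> U. loop_at X x0 \<zeta> \<and> openin X U \<and> x0 \<in> U}"

text \<open>The open sets are the unions of basis sets; \<open>openin_whisker_topology\<close> below shows that
  these do form a topology.\<close>

definition whisker_topology :: "'a topology \<Rightarrow> 'a \<Rightarrow> (real \<Rightarrow> 'a) set topology" where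
  "whisker_topology X x0 = topology (arbitrary union_of (\<lambda>N. N \<in> whisker_basis X x0))"

definition topological_group :: "('a, 'b) monoid_scheme \<Rightarrow> 'a topology \<Rightarrow> bool" where
  "topological_group G T \<longleftrightarrow>
    group G \<and> topspace T = carrier G \<and>
    continuous_map (prod_topology T T) T (\<lambda>(x, y). x \<otimes>\<^bsub>G\<^esub> y) \<and>
    continuous_map T T (\<lambda>x. inv\<^bsub>G\<^esub> x)"

definition quotient_topology :: "'a topology \<Rightarrow> ('a \<Rightarrow> 'b) \<Rightarrow> 'b topology" where
  "quotient_topology X f =
    topology (\<lambda>V. V \<subseteq> f ` topspace X \<and> openin X {x \<in> topspace X. f x \<in> V})"

lemma openin_quotient_topology:
  "openin (quotient_topology X f) V \<longleftrightarrow>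
    V \<subseteq> f ` topspace X \<and> openin X {x \<in> topspace X. f x \<in> V}"
proof -
  have 1: "{x \<in> topspace X. f x \<in> S \<inter> T} =
      {x \<in> topspace X. f x \<in> S} \<inter> {x \<in> topspace X. f x \<in> T}" for S T
    by auto
  have 2: "{x \<in> topspace X. f x \<in> \<Union> \<K>} = (\<Union>K\<in>\<K>. {x \<in> topspace X. f x \<in> K})" for \<K>
    by auto
  have "istopology (\<lambda>V. V \<subseteq> f ` topspace X \<and> openin X {x \<in> topspace X. f x \<in> V})"
    unfolding istopology_def 1 2 by blast
  then show ?thesis
    by (simp add: quotient_topology_def)
qed

lemma topspace_quotient_topology [simp]: "topspace (quotient_topology X f) = f ` topspace X"
proof -
  have "{x \<in> topspace X. f x \<in> f ` topspace X} = topspace X"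
    by auto
  then have "openin (quotient_topology X f) (f ` topspace X)"
    by (simp add: openin_quotient_topology)
  then show ?thesis
    by (metis openin_quotient_topology openin_subset openin_topspace subset_antisym)
qed

lemma quotient_map_quotient_topology: "quotient_map X (quotient_topology X f) f"
  by (simp add: quotient_map_def openin_quotient_topology)

text \<open>The wedge sum of the based spaces \<open>(X i, b i)\<close>, \<open>i \<in> I\<close>, is the quotient of their disjoint
  union in which all the base points are identified. The points of the quotient are the
  equivalence classes.\<close>

definition wedge_point :: "('i \<Rightarrow> 'a) \<Rightarrow> 'i set \<Rightarrow> ('i \<times> 'a) set" where
  "wedge_point b I = (\<lambda>i. (i, b i)) ` I"

definition wedge_proj :: "('i \<Rightarrow> 'a) \<Rightarrow> 'i set \<Rightarrow> 'i \<times> 'a \<Rightarrow> ('i \<times> 'a) set" where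
  "wedge_proj b I z = (if z \<in> wedge_point b I then wedge_point b I else {z})"

definition wedge_sum :: "('i \<Rightarrow> 'a topology) \<Rightarrow> ('i \<Rightarrow> 'a) \<Rightarrow> 'i set \<Rightarrow> ('i \<times> 'a) set topology" where
  "wedge_sum X b I = quotient_topology (sum_topology X I) (wedge_proj b I)"

text \<open>\<open>S\<^sup>1 \<or> S\<^sup>1\<close>, with \<open>S\<^sup>1\<close> the unit circle in the complex plane based at \<open>1\<close>.\<close>

definition two_circles :: "(bool \<times> complex) set topology" where
  "two_circles = wedge_sum (\<lambda>_. top_of_set (sphere 0 1)) (\<lambda>_. 1) UNIV"

definition two_circles_point :: "(bool \<times> complex) set" where
  "two_circles_point = wedge_point (\<lambda>_. 1) UNIV"

lemma continuous_map_square_piece: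
  fixes f :: "real \<times> real \<Rightarrow> 'a::topological_space"
  assumes "continuous_on S f" "\<And>z. z \<in> S \<Longrightarrow> f z \<in> T" "S \<subseteq> {0..1} \<times> {0..1}"
  shows "continuous_map (subtopology (prod_topology (top_of_set {0..1}) (top_of_set {0..1})) S)
    (top_of_set T) f"
  using assms
  by (simp add: prod_topology_subtopology_eu subtopology_subtopology Int_absorb1 image_subset_iff_funcset Pi_iff)

lemma pathin_concat_paths:
  assumes "pathin X p" "pathin X q" "p 1 = q 0"
  shows "pathin X (concat_paths p q)"
  unfolding pathin_def concat_paths_def
proof (rule continuous_map_cases_le)
  show "continuous_map (subtopology (top_of_set {0..1}) {x \<in> topspace (top_of_set {0..1}). x \<le> 1/2})
      X (\<lambda>t. p (2 * t))"
    by (rule continuous_map_compose[of _ "top_of_set {0..1}" "\<lambda>t. 2 * t" X p, unfolded o_def])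
      (use assms in \<open>auto simp: pathin_def subtopology_subtopology intro!: continuous_intros\<close>)
  show "continuous_map (subtopology (top_of_set {0..1}) {x \<in> topspace (top_of_set {0..1}). 1/2 \<le> x})
      X (\<lambda>t. q (2 * t - 1))"
    by (rule continuous_map_compose[of _ "top_of_set {0..1}" "\<lambda>t. 2 * t - 1" X q, unfolded o_def])
      (use assms in \<open>auto simp: pathin_def subtopology_subtopology intro!: continuous_intros\<close>)
  show "p (2 * t) = q (2 * t - 1)" if "t = 1/2" for t
    unfolding that using assms(3) by simp
qed (auto simp: continuous_map_from_subtopology)

lemma loop_at_concat_paths:
  "\<lbrakk>loop_at X x0 p; loop_at X x0 q\<rbrakk> \<Longrightarrow> loop_at X x0 (concat_paths p q)"
  unfolding loop_at_def by (auto simp: pathin_concat_paths) (auto simp: concat_paths_def)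

lemma loop_homotopic_refl: "loop_homotopic X x0 p p \<longleftrightarrow> loop_at X x0 p"
  by (auto simp: loop_homotopic_def loop_at_def pathin_def)

lemma loop_homotopic_sym: "loop_homotopic X x0 p q \<Longrightarrow> loop_homotopic X x0 q p"
  unfolding loop_homotopic_def by (rule homotopic_with_symD)

lemma loop_homotopic_trans:
  "\<lbrakk>loop_homotopic X x0 p q; loop_homotopic X x0 q r\<rbrakk> \<Longrightarrow> loop_homotopic X x0 p r"
  unfolding loop_homotopic_def by (rule homotopic_with_trans)

lemma loop_homotopic_imp_loop_at:
  "loop_homotopic X x0 p q \<Longrightarrow> loop_at X x0 p \<and> loop_at X x0 q"
  by (meson loop_homotopic_refl loop_homotopic_sym loop_homotopic_trans)

lemma loop_class_eq_iff:
  "loop_at X x0 p \<Longrightarrow> loop_class X x0 p = loop_class X x0 q \<longleftrightarrow> loop_homotopic X x0 p q"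
  unfolding loop_class_def
  by (auto dest: loop_homotopic_sym intro: loop_homotopic_trans simp flip: loop_homotopic_refl)

lemma loop_homotopic_concat_paths:
  assumes "loop_homotopic X x0 p p'" "loop_homotopic X x0 q q'"
  shows "loop_homotopic X x0 (concat_paths p q) (concat_paths p' q')"
proof -
  let ?I = "top_of_set {0..1::real}"
  obtain h k where h: "continuous_map (prod_topology ?I ?I) X h"
      "\<forall>x. h (0, x) = p x" "\<forall>x. h (1, x) = p' x" "\<forall>t\<in>{0..1}. h (t, 0) = x0 \<and> h (t, 1) = x0"
    and k: "continuous_map (prod_topology ?I ?I) X k"
      "\<forall>x. k (0, x) = q x" "\<forall>x. k (1, x) = q' x" "\<forall>t\<in>{0..1}. k (t, 0) = x0 \<and> k (t, 1) = x0"
    using assms unfolding loop_homotopic_def homotopic_with_def by auto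
  let ?H = "\<lambda>z. if snd z \<le> 1/2 then h (fst z, 2 * snd z) else k (fst z, 2 * snd z - 1)"
  have snd: "continuous_map (prod_topology ?I ?I) euclideanreal snd"
    by (simp add: prod_topology_subtopology_eu continuous_on_snd)
  have "continuous_map (prod_topology ?I ?I) X ?H"
  proof (rule continuous_map_cases_le)
    show "continuous_map (subtopology (prod_topology ?I ?I)
        {x \<in> topspace (prod_topology ?I ?I). snd x \<le> 1/2}) X (\<lambda>z. h (fst z, 2 * snd z))"
      by (rule continuous_map_compose[OF _ h(1), of _ "\<lambda>z. (fst z, 2 * snd z)", unfolded o_def],
          subst (2) prod_topology_subtopology_eu, rule continuous_map_square_piece)
        (auto intro!: continuous_intros)
    show "continuous_map (subtopology (prod_topology ?I ?I)
        {x \<in> topspace (prod_topology ?I ?I). 1/2 \<le> snd x}) X (\<lambda>z. k (fst z, 2 * snd z - 1))"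
      by (rule continuous_map_compose[OF _ k(1), of _ "\<lambda>z. (fst z, 2 * snd z - 1)", unfolded o_def],
          subst (2) prod_topology_subtopology_eu, rule continuous_map_square_piece)
        (auto intro!: continuous_intros)
    show "h (fst z, 2 * snd z) = k (fst z, 2 * snd z - 1)"
      if "z \<in> topspace (prod_topology ?I ?I)" "snd z = 1/2" for z
    proof -
      have z: "fst z \<in> {0..1}" "2 * snd z = 1"
        using that by auto
      with h(4) k(4) show ?thesis
        by simp
    qed
  qed (use snd in auto)
  then show ?thesis
    unfolding loop_homotopic_def homotopic_with_def
    by (intro exI[of _ ?H]) (use h k in \<open>auto simp: concat_paths_def\<close>)
qed

lemma mult_loop_class:
  assumes "loop_at X x0 p" "loop_at X x0 q"
  shows "loop_class X x0 p \<otimes>\<^bsub>fundamental_group X x0\<^esub> loop_class X x0 q =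
    loop_class X x0 (concat_paths p q)"
proof -
  have "loop_class X x0 (concat_paths p' q') = loop_class X x0 (concat_paths p q)"
    if "p' \<in> loop_class X x0 p" "q' \<in> loop_class X x0 q" for p' q'
    using that assms
    by (metis loop_class_def loop_class_eq_iff loop_homotopic_concat_paths loop_at_concat_paths
        mem_Collect_eq)
  moreover have "p \<in> loop_class X x0 p" "q \<in> loop_class X x0 q"
    using assms by (auto simp: loop_class_def loop_homotopic_refl)
  ultimately have "(\<Union>p'\<in>loop_class X x0 p. \<Union>q'\<in>loop_class X x0 q. loop_class X x0 (concat_paths p' q')) =
      loop_class X x0 (concat_paths p q)"
    by blast
  then show ?thesis
    by (simp add: fundamental_group_def)
qed

lemma loop_homotopic_reparametrize:
  assumes p: "loop_at X x0 p" and f: "continuous_on {0..1} f" "f ` {0..1} \<subseteq> {0..1}"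
    and "f 0 = 0" "f 1 = 1" and q: "\<And>t. t \<in> {0..1} \<Longrightarrow> q t = p (f t)"
  shows "loop_homotopic X x0 q p"
proof -
  let ?I = "top_of_set {0..1::real}"
  have *: "f s + t * (s - f s) \<in> {0..1}" if "s \<in> {0..1}" "t \<in> {0..1}" for s t :: real
  proof -
    have "f s \<in> {0..1}"
      using f(2) that(1) by (rule subsetD[OF _ imageI])
    with that have "(1 - t) *\<^sub>R f s + t *\<^sub>R s \<in> {0..1}"
      by (intro convexD[of "{0..1::real}"]) auto
    then show ?thesis
      by (simp add: algebra_simps)
  qed
  have cf: "continuous_on ({0..1} \<times> {0..1}) (\<lambda>z::real \<times> real. f (snd z))"
    by (rule continuous_on_compose2[OF f(1)]) (auto intro!: continuous_intros)
  have "continuous_map (prod_topology ?I ?I) X (\<lambda>z. p (f (snd z) + fst z * (snd z - f (snd z))))"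
    by (rule continuous_map_compose[of _ ?I "\<lambda>z. f (snd z) + fst z * (snd z - f (snd z))" X p,
          unfolded o_def])
      (use p * cf in \<open>auto simp: loop_at_def pathin_def prod_topology_subtopology_eu
          intro!: continuous_intros\<close>)
  then show ?thesis
    unfolding loop_homotopic_def
    by (subst homotopic_with)
      (use p assms(4,5) q in \<open>auto simp: loop_at_def
        intro!: exI[of _ "\<lambda>z. p (f (snd z) + fst z * (snd z - f (snd z)))"]\<close>)
qed

lemma loop_homotopic_concat_paths_assoc:
  assumes "loop_at X x0 p" "loop_at X x0 q" "loop_at X x0 r"
  shows "loop_homotopic X x0 (concat_paths p (concat_paths q r))
    (concat_paths (concat_paths p q) r)"
proof (rule loop_homotopic_reparametrize)
  let ?f = "\<lambda>t::real. max (min (t / 2) (1/4)) (max (min (t - 1/4) (1/2)) (2 * t - 1))"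
  show "continuous_on {0..1} ?f"
    by (intro continuous_intros) auto
  have "0 \<le> ?f t" "?f t \<le> 1" if "0 \<le> t" "t \<le> 1" for t
    using that by (simp_all add: le_max_iff_disj min_le_iff_disj)
  then show "?f ` {0..1} \<subseteq> {0..1}"
    by (simp add: image_subset_iff)
  fix t :: real assume "t \<in> {0..1}"
  consider "t \<le> 1/2" | "1/2 < t" "t \<le> 3/4" | "3/4 < t"
    by linarith
  then show "concat_paths p (concat_paths q r) t = concat_paths (concat_paths p q) r (?f t)"
  proof cases
    case 1
    then have "?f t = t / 2"
      using \<open>t \<in> {0..1}\<close> by auto
    with 1 show ?thesis
      by (simp add: concat_paths_def)
  next
    case 2
    then have "?f t = t - 1/4"
      by auto
    moreover have "2 * (2 * t - 1) = 4 * t - 2" "2 * (2 * (t - 1/4)) - 1 = 4 * t - 2"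
      by simp_all
    ultimately show ?thesis
      using 2 by (simp add: concat_paths_def)
  next
    case 3
    then have "?f t = 2 * t - 1"
      by auto
    with 3 show ?thesis
      by (simp add: concat_paths_def)
  qed
qed (use assms in \<open>auto simp: loop_at_concat_paths\<close>)

lemma concat_paths_image_subset:
  "\<lbrakk>p ` {0..1} \<subseteq> U; q ` {0..1} \<subseteq> U\<rbrakk> \<Longrightarrow> concat_paths p q ` {0..1} \<subseteq> U"
  by (auto simp: concat_paths_def image_subset_iff)

lemma whisker_nbhd_recentre:
  assumes "loop_at X x0 \<zeta>" "loop_at X x0 \<gamma>" "loop_class X x0 \<gamma> \<in> whisker_nbhd X x0 \<zeta> U" "V \<subseteq> U"
  shows "whisker_nbhd X x0 \<gamma> V \<subseteq> whisker_nbhd X x0 \<zeta> U"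
proof
  fix c assume "c \<in> whisker_nbhd X x0 \<gamma> V"
  then obtain \<theta> where \<theta>: "c = loop_class X x0 (concat_paths \<gamma> \<theta>)" "loop_at X x0 \<theta>" "\<theta> ` {0..1} \<subseteq> U"
    using assms(4) by (auto simp: whisker_nbhd_def)
  obtain \<eta> where \<eta>: "loop_homotopic X x0 \<gamma> (concat_paths \<zeta> \<eta>)" "loop_at X x0 \<eta>" "\<eta> ` {0..1} \<subseteq> U"
    using assms(2,3) by (auto simp: whisker_nbhd_def loop_class_eq_iff)
  have "loop_homotopic X x0 (concat_paths \<gamma> \<theta>) (concat_paths \<zeta> (concat_paths \<eta> \<theta>))"
    by (meson \<theta>(2) \<eta>(1,2) assms(1) loop_homotopic_concat_paths loop_homotopic_concat_paths_assoc
        loop_homotopic_refl loop_homotopic_sym loop_homotopic_trans)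
  then have "c = loop_class X x0 (concat_paths \<zeta> (concat_paths \<eta> \<theta>))"
    using \<theta> assms(2) by (simp add: loop_class_eq_iff loop_at_concat_paths)
  moreover have "loop_at X x0 (concat_paths \<eta> \<theta>)"
    using \<theta>(2) \<eta>(2) by (rule loop_at_concat_paths[rotated])
  moreover have "concat_paths \<eta> \<theta> ` {0..1} \<subseteq> U"
    using \<theta>(3) \<eta>(3) by (rule concat_paths_image_subset[rotated])
  ultimately show "c \<in> whisker_nbhd X x0 \<zeta> U"
    unfolding whisker_nbhd_def by (intro CollectI exI[of _ "concat_paths \<eta> \<theta>"] conjI)
qed

lemma loop_class_mem_whisker_nbhd:
  assumes "loop_at X x0 \<gamma>" "x0 \<in> U"
  shows "loop_class X x0 \<gamma> \<in> whisker_nbhd X x0 \<gamma> U"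
proof -
  have x0: "x0 \<in> topspace X"
    using assms by (auto simp: loop_at_def pathin_def continuous_map_def)
  then have const: "loop_at X x0 (\<lambda>_. x0)"
    by (simp add: loop_at_def pathin_def)
  have "loop_homotopic X x0 (concat_paths \<gamma> (\<lambda>_. x0)) \<gamma>"
  proof (rule loop_homotopic_reparametrize)
    show "continuous_on {0..1} (\<lambda>t::real. min (2 * t) 1)"
      by (intro continuous_intros)
  qed (use assms in \<open>auto simp: concat_paths_def loop_at_def min_def\<close>)
  then have "loop_class X x0 \<gamma> = loop_class X x0 (concat_paths \<gamma> (\<lambda>_. x0))"
    using assms loop_class_eq_iff loop_homotopic_sym by metis
  with const assms show ?thesis
    unfolding whisker_nbhd_def by (intro CollectI exI[of _ "\<lambda>_. x0"]) auto
qed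

lemma openin_whisker_topology:
  "openin (whisker_topology X x0) = arbitrary union_of (\<lambda>N. N \<in> whisker_basis X x0)"
proof -
  have "(arbitrary union_of (\<lambda>N. N \<in> whisker_basis X x0)) (N1 \<inter> N2)"
    if N: "N1 \<in> whisker_basis X x0" "N2 \<in> whisker_basis X x0" for N1 N2
  proof -
    obtain p U q V where p: "N1 = whisker_nbhd X x0 p U" "loop_at X x0 p" "openin X U" "x0 \<in> U"
      and q: "N2 = whisker_nbhd X x0 q V" "loop_at X x0 q" "openin X V" "x0 \<in> V"
      using N unfolding whisker_basis_def by blast
    have "\<exists>N \<in> whisker_basis X x0. c \<in> N \<and> N \<subseteq> N1 \<inter> N2" if c: "c \<in> N1 \<inter> N2" for c
    proof -
      obtain \<gamma> where \<gamma>: "c = loop_class X x0 \<gamma>" "loop_at X x0 \<gamma>"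
        using c p by (auto simp: whisker_nbhd_def intro: loop_at_concat_paths)
      show ?thesis
      proof (intro bexI conjI)
        show "whisker_nbhd X x0 \<gamma> (U \<inter> V) \<in> whisker_basis X x0"
          using p q \<gamma> unfolding whisker_basis_def by blast
        show "c \<in> whisker_nbhd X x0 \<gamma> (U \<inter> V)"
          using p q \<gamma> by (simp add: loop_class_mem_whisker_nbhd)
        show "whisker_nbhd X x0 \<gamma> (U \<inter> V) \<subseteq> N1 \<inter> N2"
          using p q \<gamma> c by (simp add: whisker_nbhd_recentre)
      qed
    qed
    then show ?thesis
      by (subst arbitrary_union_of_alt) blast
  qed
  then have "istopology (arbitrary union_of (\<lambda>N. N \<in> whisker_basis X x0))"
    by (simp add: istopology_base_alt arbitrary_union_of_Int_eq)
  then show ?thesis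
    by (simp add: whisker_topology_def)
qed

end

theory Submission
  imports Defs "HOL-Complex_Analysis.Winding_Numbers"
begin

text \<open>In the whisker topology the open neighbourhoods of a class \<open>g\<close> are generated by the cosets
  \<open>g S(U)\<close>, where \<open>S(U)\<close> is the subgroup of classes of loops that stay in the neighbourhood \<open>U\<close> of
  the base point. So every topological property of the group is a statement about these subgroups:
  the group is topological as soon as each conjugate of an \<open>S(U)\<close> contains some \<open>S(V)\<close>
  (\<open>topological_group_whisker_topology\<close>), it is Hausdorff as soon as the \<open>S(U)\<close> intersect in the
  trivial group (\<open>Hausdorff_space_whisker_topology\<close>), and it is discrete only if some \<open>S(U)\<close> is
  trivial (\<open>discrete_whisker_topologyD\<close>).

  Homotopy of loops in a product is coordinatewise homotopy. Suppose that the base point of every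
  factor has a neighbourhood whose loops are all nullhomotopic in the factor. A basic neighbourhood
  \<open>U\<close> of the base point of the product restricts only finitely many coordinates; shrinking it to such
  a neighbourhood in each of these coordinates gives a \<open>V\<close> whose loops, and the conjugates of these
  loops, are trivial in the restricted coordinates. A conjugate can then be made constant there, and it
  lies in \<open>U\<close>. The same neighbourhoods, taken one coordinate at a time, separate the classes. On the
  other hand each \<open>S(U)\<close> contains everything supported in an unrestricted coordinate, so the group
  is not discrete if infinitely many factors carry an essential loop.

  It remains to see that \<open>S\<^sup>1 \<or> S\<^sup>1\<close> is such a factor and that its fundamental group is not abelian.
  Both use the retractions onto the two circles, one of which is always \<open>1\<close>. The two open half circles
  at the wedge point contract, which settles the first claim. For the second, suppose that the
  commutator of the two circles were nullhomotopic
  (\<open>commutator_circle_loops_not_nullhomotopic\<close>). Composing the homotopy with the retractions and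
  taking logarithms lifts it to the plane, where it stays in the grid of points with an integer
  coordinate; it contracts the boundary of the unit square within this grid. But the grid misses the
  centre of the square, about which the boundary has winding number \<open>1\<close>.\<close>

section \<open>Loops and the fundamental group\<close>

text \<open>The formula of \<^const>\<open>reversepath\<close>, for points of an arbitrary type.\<close>

definition reverse_loop :: "(real \<Rightarrow> 'a) \<Rightarrow> real \<Rightarrow> 'a" where
  "reverse_loop p = (\<lambda>t. p (1 - t))"

lemma reverse_loop_reverse_loop [simp]: "reverse_loop (reverse_loop p) = p"
  by (simp add: reverse_loop_def)

lemma loop_at_const: "x0 \<in> topspace X \<Longrightarrow> loop_at X x0 (\<lambda>_. x0)"
  by (simp add: loop_at_def pathin_def)

lemma loop_at_imp_in_topspace: "loop_at X x0 p \<Longrightarrow> x0 \<in> topspace X"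
  by (auto simp: loop_at_def pathin_def continuous_map_def)

lemma loop_at_reverse_loop:
  assumes "loop_at X x0 p"
  shows "loop_at X x0 (reverse_loop p)"
proof -
  have "continuous_map (top_of_set {0..1}) X (p \<circ> (\<lambda>t. 1 - t))"
    by (rule continuous_map_compose[of _ "top_of_set {0..1}"])
      (use assms in \<open>auto simp: loop_at_def pathin_def intro!: continuous_intros\<close>)
  with assms show ?thesis
    by (simp add: loop_at_def pathin_def reverse_loop_def o_def)
qed

text \<open>A loop \<open>p \<circ> f\<close>, where \<open>f\<close> itself is a loop at \<open>0\<close> in the interval, shrinks to the base point because
  \<open>f\<close> can be scaled down to \<open>0\<close>. A loop followed by its reverse has this form, with \<open>f\<close> running
  up and back.\<close>

lemma loop_homotopic_const_reparametrize:
  assumes p: "loop_at X x0 p" and f: "continuous_on {0..1} f" "f ` {0..1} \<subseteq> {0..1}"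
    and "f 0 = 0" "f 1 = 0" and q: "\<And>t. t \<in> {0..1} \<Longrightarrow> q t = p (f t)"
  shows "loop_homotopic X x0 q (\<lambda>_. x0)"
proof -
  let ?I = "top_of_set {0..1::real}"
  have *: "(1 - s) * f t \<in> {0..1}" if "s \<in> {0..1}" "t \<in> {0..1}" for s t :: real
    using that f(2) by (auto simp: image_subset_iff intro: mult_le_one)
  have cf: "continuous_on ({0..1} \<times> {0..1}) (\<lambda>z::real \<times> real. f (snd z))"
    by (rule continuous_on_compose2[OF f(1)]) (auto intro!: continuous_intros)
  have "continuous_map (prod_topology ?I ?I) X (\<lambda>z. p ((1 - fst z) * f (snd z)))"
    by (rule continuous_map_compose[of _ ?I "\<lambda>z. (1 - fst z) * f (snd z)" X p, unfolded o_def])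
      (use p * cf in \<open>auto simp: loop_at_def pathin_def prod_topology_subtopology_eu
          intro!: continuous_intros\<close>)
  then show ?thesis
    unfolding loop_homotopic_def
    by (subst homotopic_with)
      (use p assms(4,5) q in \<open>auto simp: loop_at_def
        intro!: exI[of _ "\<lambda>z. p ((1 - fst z) * f (snd z))"]\<close>)
qed

lemma loop_homotopic_concat_paths_reverse_loop:
  assumes "loop_at X x0 p"
  shows "loop_homotopic X x0 (concat_paths p (reverse_loop p)) (\<lambda>_. x0)"
proof (rule loop_homotopic_const_reparametrize[OF assms])
  show "continuous_on {0..1} (\<lambda>t::real. min (2 * t) (2 - 2 * t))"
    by (intro continuous_intros)
qed (auto simp: concat_paths_def reverse_loop_def min_def)

lemma loop_homotopic_const_concat_paths:
  assumes "loop_at X x0 p"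
  shows "loop_homotopic X x0 (concat_paths (\<lambda>_. x0) p) p"
proof (rule loop_homotopic_reparametrize[OF assms])
  show "continuous_on {0..1} (\<lambda>t::real. max 0 (2 * t - 1))"
    by (intro continuous_intros)
  show "concat_paths (\<lambda>_. x0) p t = p (max 0 (2 * t - 1))" if "t \<in> {0..1}" for t
  proof (cases "t \<le> 1/2")
    case True
    then have "max 0 (2 * t - 1) = 0"
      by simp
    with True assms show ?thesis
      by (simp add: concat_paths_def loop_at_def)
  qed (auto simp: concat_paths_def)
qed auto

lemma carrier_fundamental_group:
  "carrier (fundamental_group X x0) = {loop_class X x0 p |p. loop_at X x0 p}"
  by (simp add: fundamental_group_def)

lemma one_fundamental_group: "\<one>\<^bsub>fundamental_group X x0\<^esub> = loop_class X x0 (\<lambda>_. x0)"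
  by (simp add: fundamental_group_def)

lemma loop_class_eqI: "loop_homotopic X x0 p q \<Longrightarrow> loop_class X x0 p = loop_class X x0 q"
  using loop_class_eq_iff loop_homotopic_imp_loop_at by metis

lemma loop_class_reverse_loop_mult:
  assumes "loop_at X x0 p"
  shows "loop_class X x0 (reverse_loop p) \<otimes>\<^bsub>fundamental_group X x0\<^esub> loop_class X x0 p
    = \<one>\<^bsub>fundamental_group X x0\<^esub>"
  using loop_homotopic_concat_paths_reverse_loop[OF loop_at_reverse_loop[OF assms]] assms
  by (simp add: mult_loop_class loop_at_reverse_loop one_fundamental_group loop_class_eqI)

lemma group_fundamental_group:
  assumes "x0 \<in> topspace X"
  shows "group (fundamental_group X x0)"
proof (rule groupI)
  show "x \<otimes>\<^bsub>fundamental_group X x0\<^esub> y \<in> carrier (fundamental_group X x0)"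
    if "x \<in> carrier (fundamental_group X x0)" "y \<in> carrier (fundamental_group X x0)" for x y
    using that by (auto simp: carrier_fundamental_group mult_loop_class intro: loop_at_concat_paths)
  show "\<one>\<^bsub>fundamental_group X x0\<^esub> \<in> carrier (fundamental_group X x0)"
    using assms by (auto simp: carrier_fundamental_group one_fundamental_group intro: loop_at_const)
  show "x \<otimes>\<^bsub>fundamental_group X x0\<^esub> y \<otimes>\<^bsub>fundamental_group X x0\<^esub> z =
      x \<otimes>\<^bsub>fundamental_group X x0\<^esub> (y \<otimes>\<^bsub>fundamental_group X x0\<^esub> z)"
    if xyz: "x \<in> carrier (fundamental_group X x0)" "y \<in> carrier (fundamental_group X x0)"
      "z \<in> carrier (fundamental_group X x0)" for x y z
  proof -
    obtain p q r where "x = loop_class X x0 p" "loop_at X x0 p" "y = loop_class X x0 q" "loop_at X x0 q"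
      "z = loop_class X x0 r" "loop_at X x0 r"
      using xyz unfolding carrier_fundamental_group by blast
    then show ?thesis
      using loop_class_eqI[OF loop_homotopic_concat_paths_assoc[of X x0 p q r]]
      by (simp add: mult_loop_class loop_at_concat_paths)
  qed
  show "\<one>\<^bsub>fundamental_group X x0\<^esub> \<otimes>\<^bsub>fundamental_group X x0\<^esub> x = x"
    if x: "x \<in> carrier (fundamental_group X x0)" for x
  proof -
    obtain p where p: "x = loop_class X x0 p" "loop_at X x0 p"
      using x unfolding carrier_fundamental_group by blast
    show ?thesis
      unfolding one_fundamental_group p(1) mult_loop_class[OF loop_at_const[OF assms] p(2)]
      using loop_homotopic_const_concat_paths[OF p(2)] by (rule loop_class_eqI)
  qed
  show "\<exists>y\<in>carrier (fundamental_group X x0). y \<otimes>\<^bsub>fundamental_group X x0\<^esub> x = \<one>\<^bsub>fundamental_group X x0\<^esub>"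
    if x: "x \<in> carrier (fundamental_group X x0)" for x
  proof -
    obtain p where p: "x = loop_class X x0 p" "loop_at X x0 p"
      using x unfolding carrier_fundamental_group by blast
    have "loop_class X x0 (reverse_loop p) \<in> carrier (fundamental_group X x0)"
      using loop_at_reverse_loop[OF p(2)] unfolding carrier_fundamental_group by blast
    then show ?thesis
      using loop_class_reverse_loop_mult[OF p(2)] unfolding p(1) by (rule bexI[rotated])
  qed
qed

lemma inv_loop_class:
  assumes "loop_at X x0 p"
  shows "inv\<^bsub>fundamental_group X x0\<^esub> (loop_class X x0 p) = loop_class X x0 (reverse_loop p)"
proof -
  interpret group "fundamental_group X x0"
    using group_fundamental_group loop_at_imp_in_topspace assms by metis
  show ?thesis
    using assms loop_class_reverse_loop_mult[OF assms]
    by (intro inv_equality) (auto simp: carrier_fundamental_group intro: loop_at_reverse_loop)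
qed

section \<open>The whisker topology as a coset topology\<close>

definition small_loop_classes :: "'a topology \<Rightarrow> 'a \<Rightarrow> 'a set \<Rightarrow> (real \<Rightarrow> 'a) set set" where
  "small_loop_classes X x0 U = {loop_class X x0 \<eta> |\<eta>. loop_at X x0 \<eta> \<and> \<eta> ` {0..1} \<subseteq> U}"

lemma subgroup_small_loop_classes:
  assumes "x0 \<in> topspace X" "x0 \<in> U"
  shows "subgroup (small_loop_classes X x0 U) (fundamental_group X x0)"
proof (rule group.subgroupI[OF group_fundamental_group[OF assms(1)]])
  show "small_loop_classes X x0 U \<subseteq> carrier (fundamental_group X x0)"
    unfolding small_loop_classes_def carrier_fundamental_group by blast
  show "small_loop_classes X x0 U \<noteq> {}"
    using assms loop_at_const by (fastforce simp: small_loop_classes_def)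
  show "inv\<^bsub>fundamental_group X x0\<^esub> a \<in> small_loop_classes X x0 U"
    if a: "a \<in> small_loop_classes X x0 U" for a
  proof -
    obtain \<eta> where \<eta>: "a = loop_class X x0 \<eta>" "loop_at X x0 \<eta>" "\<eta> ` {0..1} \<subseteq> U"
      using a unfolding small_loop_classes_def by blast
    then have "reverse_loop \<eta> ` {0..1} \<subseteq> U"
      by (auto simp: reverse_loop_def image_subset_iff)
    moreover have "loop_at X x0 (reverse_loop \<eta>)"
      using \<eta>(2) by (rule loop_at_reverse_loop)
    ultimately show ?thesis
      using \<eta>(1,2) unfolding small_loop_classes_def by (auto simp: inv_loop_class)
  qed
  show "a \<otimes>\<^bsub>fundamental_group X x0\<^esub> b \<in> small_loop_classes X x0 U"
    if ab: "a \<in> small_loop_classes X x0 U" "b \<in> small_loop_classes X x0 U" for a b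
  proof -
    obtain \<eta> \<theta> where *: "a = loop_class X x0 \<eta>" "loop_at X x0 \<eta>" "\<eta> ` {0..1} \<subseteq> U"
      "b = loop_class X x0 \<theta>" "loop_at X x0 \<theta>" "\<theta> ` {0..1} \<subseteq> U"
      using ab unfolding small_loop_classes_def by blast
    then have "a \<otimes>\<^bsub>fundamental_group X x0\<^esub> b = loop_class X x0 (concat_paths \<eta> \<theta>)"
      by (simp add: mult_loop_class)
    moreover have "loop_at X x0 (concat_paths \<eta> \<theta>)" "concat_paths \<eta> \<theta> ` {0..1} \<subseteq> U"
      using * by (simp_all only: loop_at_concat_paths concat_paths_image_subset)
    ultimately show ?thesis
      unfolding small_loop_classes_def by blast
  qed
qed

text \<open>From here on no paths need to be concatenated: the basic open sets are the left cosets of the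
  subgroups \<^const>\<open>small_loop_classes\<close>.\<close>

lemma whisker_nbhd_eq_coset:
  assumes "loop_at X x0 \<zeta>"
  shows "whisker_nbhd X x0 \<zeta> U =
    (\<lambda>s. loop_class X x0 \<zeta> \<otimes>\<^bsub>fundamental_group X x0\<^esub> s) ` small_loop_classes X x0 U"
proof -
  have "loop_class X x0 \<zeta> \<otimes>\<^bsub>fundamental_group X x0\<^esub> loop_class X x0 \<eta> =
      loop_class X x0 (concat_paths \<zeta> \<eta>)" if "loop_at X x0 \<eta>" for \<eta>
    using assms that by (rule mult_loop_class)
  then show ?thesis
    unfolding whisker_nbhd_def small_loop_classes_def image_def by (auto; metis)
qed

lemma openin_whisker_topology_iff:
  assumes x0: "x0 \<in> topspace X"
  shows "openin (whisker_topology X x0) N \<longleftrightarrow> N \<subseteq> carrier (fundamental_group X x0) \<and>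
    (\<forall>g\<in>N. \<exists>U. openin X U \<and> x0 \<in> U \<and>
      (\<forall>s\<in>small_loop_classes X x0 U. g \<otimes>\<^bsub>fundamental_group X x0\<^esub> s \<in> N))"
    (is "?L \<longleftrightarrow> ?R")
proof -
  have L: "?L \<longleftrightarrow> (\<forall>g\<in>N. \<exists>B\<in>whisker_basis X x0. g \<in> B \<and> B \<subseteq> N)"
    unfolding openin_whisker_topology arbitrary_union_of_alt by blast
  show ?thesis
  proof
    assume ?L
    show ?R
    proof (intro conjI ballI subsetI)
      fix g assume "g \<in> N"
      then obtain \<zeta> U where *: "g \<in> whisker_nbhd X x0 \<zeta> U" "whisker_nbhd X x0 \<zeta> U \<subseteq> N"
          "loop_at X x0 \<zeta>" "openin X U" "x0 \<in> U"
        using \<open>?L\<close> unfolding L whisker_basis_def by blast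
      then obtain \<gamma> where \<gamma>: "g = loop_class X x0 \<gamma>" "loop_at X x0 \<gamma>"
        by (auto simp: whisker_nbhd_def intro: loop_at_concat_paths)
      then show "g \<in> carrier (fundamental_group X x0)"
        by (auto simp: carrier_fundamental_group)
      have "whisker_nbhd X x0 \<gamma> U \<subseteq> N"
        using whisker_nbhd_recentre[of X x0 \<zeta> \<gamma> U U] * \<gamma> by auto
      then show "\<exists>U. openin X U \<and> x0 \<in> U \<and>
          (\<forall>s\<in>small_loop_classes X x0 U. g \<otimes>\<^bsub>fundamental_group X x0\<^esub> s \<in> N)"
        using * \<gamma> by (auto simp: whisker_nbhd_eq_coset)
    qed
  next
    assume R: ?R
    show ?L unfolding L
    proof
      fix g assume "g \<in> N"
      then obtain U where U: "openin X U" "x0 \<in> U"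
        "\<forall>s\<in>small_loop_classes X x0 U. g \<otimes>\<^bsub>fundamental_group X x0\<^esub> s \<in> N"
        using R by blast
      obtain \<gamma> where \<gamma>: "g = loop_class X x0 \<gamma>" "loop_at X x0 \<gamma>"
        using R \<open>g \<in> N\<close> unfolding carrier_fundamental_group by blast
      with U have "whisker_nbhd X x0 \<gamma> U \<in> whisker_basis X x0" "g \<in> whisker_nbhd X x0 \<gamma> U"
          "whisker_nbhd X x0 \<gamma> U \<subseteq> N"
        unfolding whisker_basis_def
        by (blast, simp add: loop_class_mem_whisker_nbhd, auto simp: whisker_nbhd_eq_coset)
      then show "\<exists>B\<in>whisker_basis X x0. g \<in> B \<and> B \<subseteq> N"
        by blast
    qed
  qed
qed

lemma topspace_whisker_topology:
  assumes "x0 \<in> topspace X"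
  shows "topspace (whisker_topology X x0) = carrier (fundamental_group X x0)"
proof -
  interpret group "fundamental_group X x0"
    using assms by (rule group_fundamental_group)
  have "openin (whisker_topology X x0) (carrier (fundamental_group X x0))"
    using assms subgroup.subset[OF subgroup_small_loop_classes[OF assms assms]]
    by (auto simp: openin_whisker_topology_iff intro!: exI[of _ "topspace X"])
  then show ?thesis
    by (metis assms openin_subset openin_topspace openin_whisker_topology_iff subset_antisym)
qed

text \<open>A subgroup absorbs its own right translates, so each point of a coset has the same coset as a
  neighbourhood.\<close>

lemma openin_small_coset:
  assumes "openin X U" "x0 \<in> U" and g: "g \<in> carrier (fundamental_group X x0)"
  shows "openin (whisker_topology X x0)
    ((\<lambda>s. g \<otimes>\<^bsub>fundamental_group X x0\<^esub> s) ` small_loop_classes X x0 U)"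
proof -
  have x0: "x0 \<in> topspace X"
    using assms openin_subset by blast
  interpret group "fundamental_group X x0"
    using x0 by (rule group_fundamental_group)
  interpret S: subgroup "small_loop_classes X x0 U" "fundamental_group X x0"
    using x0 assms(2) by (rule subgroup_small_loop_classes)
  show ?thesis
    unfolding openin_whisker_topology_iff[OF x0]
  proof (intro conjI ballI)
    fix h assume "h \<in> (\<lambda>s. g \<otimes>\<^bsub>fundamental_group X x0\<^esub> s) ` small_loop_classes X x0 U"
    then obtain s where s: "s \<in> small_loop_classes X x0 U" "h = g \<otimes>\<^bsub>fundamental_group X x0\<^esub> s"
      by blast
    then have "h \<otimes>\<^bsub>fundamental_group X x0\<^esub> s' = g \<otimes>\<^bsub>fundamental_group X x0\<^esub> (s \<otimes>\<^bsub>fundamental_group X x0\<^esub> s')"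
      if "s' \<in> small_loop_classes X x0 U" for s'
      using that g by (simp add: m_assoc)
    then show "\<exists>U'. openin X U' \<and> x0 \<in> U' \<and> (\<forall>s'\<in>small_loop_classes X x0 U'.
        h \<otimes>\<^bsub>fundamental_group X x0\<^esub> s' \<in> (\<lambda>s. g \<otimes>\<^bsub>fundamental_group X x0\<^esub> s) ` small_loop_classes X x0 U)"
      using assms(1,2) s by (intro exI[of _ U]) auto
  qed (use g in auto)
qed

text \<open>Left translations are homeomorphisms of any coset topology. What can fail is the continuity of
  right translations and of the inverse, and the conjugation hypothesis supplies exactly that.\<close>

theorem topological_group_whisker_topology:
  assumes x0: "x0 \<in> topspace X"
    and conj: "\<And>g U. \<lbrakk>g \<in> carrier (fundamental_group X x0); openin X U; x0 \<in> U\<rbrakk> \<Longrightarrow>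
      \<exists>V. openin X V \<and> x0 \<in> V \<and> (\<forall>s\<in>small_loop_classes X x0 V.
        inv\<^bsub>fundamental_group X x0\<^esub> g \<otimes>\<^bsub>fundamental_group X x0\<^esub> s \<otimes>\<^bsub>fundamental_group X x0\<^esub> g
          \<in> small_loop_classes X x0 U)"
  shows "topological_group (fundamental_group X x0) (whisker_topology X x0)"
proof -
  define G where "G = fundamental_group X x0"
  let ?W = "whisker_topology X x0" and ?S = "small_loop_classes X x0"
  interpret group G
    unfolding G_def using x0 by (rule group_fundamental_group)
  have sub: "subgroup (?S U) G" if "x0 \<in> U" for U
    unfolding G_def using x0 that by (rule subgroup_small_loop_classes)
  have top: "topspace ?W = carrier G"
    unfolding G_def using x0 by (rule topspace_whisker_topology)
  note open_iff = openin_whisker_topology_iff[OF x0, folded G_def]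
  note coset = openin_small_coset[of X _ x0, folded G_def]
  note conj = conj[folded G_def]
  have cancel: "x \<otimes>\<^bsub>G\<^esub> (inv\<^bsub>G\<^esub> x \<otimes>\<^bsub>G\<^esub> y) = y" "inv\<^bsub>G\<^esub> x \<otimes>\<^bsub>G\<^esub> (x \<otimes>\<^bsub>G\<^esub> y) = y"
    if "x \<in> carrier G" "y \<in> carrier G" for x y
    using that by (simp_all flip: m_assoc)
  have mult: "continuous_map (prod_topology ?W ?W) ?W (\<lambda>(x, y). x \<otimes>\<^bsub>G\<^esub> y)"
    unfolding continuous_map_def
  proof (intro conjI allI impI)
    show "(\<lambda>(x, y). x \<otimes>\<^bsub>G\<^esub> y) \<in> topspace (prod_topology ?W ?W) \<rightarrow> topspace ?W"
      by (auto simp: top)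
    fix N assume N: "openin ?W N"
    show "openin (prod_topology ?W ?W)
        {z \<in> topspace (prod_topology ?W ?W). (case z of (x, y) \<Rightarrow> x \<otimes>\<^bsub>G\<^esub> y) \<in> N}"
      unfolding openin_prod_topology_alt
    proof (intro allI impI)
      fix a b assume ab: "(a, b) \<in> {z \<in> topspace (prod_topology ?W ?W).
        (case z of (x, y) \<Rightarrow> x \<otimes>\<^bsub>G\<^esub> y) \<in> N}"
      then have a: "a \<in> carrier G" and b: "b \<in> carrier G" and abN: "a \<otimes>\<^bsub>G\<^esub> b \<in> N"
        by (auto simp: top)
      obtain U where U: "openin X U" "x0 \<in> U" "\<forall>s\<in>?S U. a \<otimes>\<^bsub>G\<^esub> b \<otimes>\<^bsub>G\<^esub> s \<in> N"
        using N abN unfolding open_iff by blast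
      obtain V where V: "openin X V" "x0 \<in> V" "\<forall>s\<in>?S V. inv\<^bsub>G\<^esub> b \<otimes>\<^bsub>G\<^esub> s \<otimes>\<^bsub>G\<^esub> b \<in> ?S U"
        using conj[OF b U(1,2)] by blast
      interpret SU: subgroup "?S U" G using sub U by blast
      interpret SV: subgroup "?S V" G using sub V by blast
      have "a \<otimes>\<^bsub>G\<^esub> s \<otimes>\<^bsub>G\<^esub> (b \<otimes>\<^bsub>G\<^esub> t) \<in> N" if st: "s \<in> ?S V" "t \<in> ?S U" for s t
      proof -
        \<comment> \<open>Move \<open>s\<close> to the right past \<open>b\<close>: \<open>(a s)(b t) = (a b)((b\<inverse> s b) t)\<close>.\<close>
        have "a \<otimes>\<^bsub>G\<^esub> s \<otimes>\<^bsub>G\<^esub> (b \<otimes>\<^bsub>G\<^esub> t) =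
            a \<otimes>\<^bsub>G\<^esub> b \<otimes>\<^bsub>G\<^esub> ((inv\<^bsub>G\<^esub> b \<otimes>\<^bsub>G\<^esub> s \<otimes>\<^bsub>G\<^esub> b) \<otimes>\<^bsub>G\<^esub> t)"
          using a b st by (simp add: m_assoc cancel)
        then show ?thesis
          using U V st by auto
      qed
      moreover have "c \<in> carrier G" if "c \<in> (\<lambda>s. a \<otimes>\<^bsub>G\<^esub> s) ` ?S V" for c
        using that a by auto
      moreover have "c \<in> carrier G" if "c \<in> (\<lambda>s. b \<otimes>\<^bsub>G\<^esub> s) ` ?S U" for c
        using that b by auto
      moreover have "a \<in> (\<lambda>s. a \<otimes>\<^bsub>G\<^esub> s) ` ?S V" "b \<in> (\<lambda>s. b \<otimes>\<^bsub>G\<^esub> s) ` ?S U"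
        using a b by (auto intro!: image_eqI[of _ _ "\<one>\<^bsub>G\<^esub>"])
      ultimately show "\<exists>A B. openin ?W A \<and> openin ?W B \<and> a \<in> A \<and> b \<in> B \<and>
          A \<times> B \<subseteq> {z \<in> topspace (prod_topology ?W ?W). (case z of (x, y) \<Rightarrow> x \<otimes>\<^bsub>G\<^esub> y) \<in> N}"
        by (intro exI[of _ "(\<lambda>s. a \<otimes>\<^bsub>G\<^esub> s) ` ?S V"] exI[of _ "(\<lambda>s. b \<otimes>\<^bsub>G\<^esub> s) ` ?S U"] conjI
            coset U V a b) (auto simp: top)
    qed
  qed
  have inv: "continuous_map ?W ?W (\<lambda>x. inv\<^bsub>G\<^esub> x)"
    unfolding continuous_map_def
  proof (intro conjI allI impI)
    show "(\<lambda>x. inv\<^bsub>G\<^esub> x) \<in> topspace ?W \<rightarrow> topspace ?W"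
      by (auto simp: top)
    fix N assume N: "openin ?W N"
    show "openin ?W {x \<in> topspace ?W. inv\<^bsub>G\<^esub> x \<in> N}"
      unfolding open_iff
    proof (intro conjI ballI)
      fix a assume "a \<in> {x \<in> topspace ?W. inv\<^bsub>G\<^esub> x \<in> N}"
      then have a: "a \<in> carrier G" "inv\<^bsub>G\<^esub> a \<in> N"
        by (auto simp: top)
      obtain U where U: "openin X U" "x0 \<in> U" "\<forall>s\<in>?S U. inv\<^bsub>G\<^esub> a \<otimes>\<^bsub>G\<^esub> s \<in> N"
        using N a unfolding open_iff by blast
      obtain V where V: "openin X V" "x0 \<in> V"
          "\<forall>s\<in>?S V. inv\<^bsub>G\<^esub> (inv\<^bsub>G\<^esub> a) \<otimes>\<^bsub>G\<^esub> s \<otimes>\<^bsub>G\<^esub> (inv\<^bsub>G\<^esub> a) \<in> ?S U"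
        using conj[OF inv_closed[OF a(1)] U(1,2)] by blast
      interpret SU: subgroup "?S U" G using sub U by blast
      interpret SV: subgroup "?S V" G using sub V by blast
      have "a \<otimes>\<^bsub>G\<^esub> s \<in> {x \<in> topspace ?W. inv\<^bsub>G\<^esub> x \<in> N}" if s: "s \<in> ?S V" for s
      proof -
        \<comment> \<open>Likewise \<open>(a s)\<inverse> = a\<inverse> (a s\<inverse> a\<inverse>)\<close>.\<close>
        have "inv\<^bsub>G\<^esub> (a \<otimes>\<^bsub>G\<^esub> s) = inv\<^bsub>G\<^esub> a \<otimes>\<^bsub>G\<^esub> (a \<otimes>\<^bsub>G\<^esub> inv\<^bsub>G\<^esub> s \<otimes>\<^bsub>G\<^esub> inv\<^bsub>G\<^esub> a)"
          using a s by (simp add: inv_mult_group m_assoc cancel)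
        moreover have "a \<otimes>\<^bsub>G\<^esub> inv\<^bsub>G\<^esub> s \<otimes>\<^bsub>G\<^esub> inv\<^bsub>G\<^esub> a \<in> ?S U"
          using V(3) a s SV.m_inv_closed by fastforce
        ultimately show ?thesis
          using U a s by (auto simp: top)
      qed
      then show "\<exists>V. openin X V \<and> x0 \<in> V \<and>
          (\<forall>s\<in>?S V. a \<otimes>\<^bsub>G\<^esub> s \<in> {x \<in> topspace ?W. inv\<^bsub>G\<^esub> x \<in> N})"
        using V by blast
    qed (auto simp: top)
  qed
  show ?thesis
    unfolding topological_group_def
    using mult inv top group_axioms by (simp add: G_def)
qed

text \<open>If \<open>g\<inverse> h\<close> is not in the subgroup of \<open>U\<close>, then the cosets of \<open>g\<close> and \<open>h\<close> are distinct, hence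
  disjoint.\<close>

theorem Hausdorff_space_whisker_topology:
  assumes x0: "x0 \<in> topspace X"
    and sep: "\<And>g. \<lbrakk>g \<in> carrier (fundamental_group X x0); g \<noteq> \<one>\<^bsub>fundamental_group X x0\<^esub>\<rbrakk> \<Longrightarrow>
      \<exists>U. openin X U \<and> x0 \<in> U \<and> g \<notin> small_loop_classes X x0 U"
  shows "Hausdorff_space (whisker_topology X x0)"
  unfolding Hausdorff_space_def topspace_whisker_topology[OF x0]
proof (intro allI impI, elim conjE)
  define G where "G = fundamental_group X x0"
  interpret group G
    unfolding G_def using x0 by (rule group_fundamental_group)
  fix g h assume "g \<in> carrier (fundamental_group X x0)" "h \<in> carrier (fundamental_group X x0)" "g \<noteq> h"
  then have gh: "g \<in> carrier G" "h \<in> carrier G" "inv\<^bsub>G\<^esub> g \<otimes>\<^bsub>G\<^esub> h \<noteq> \<one>\<^bsub>G\<^esub>"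
    by (auto simp: G_def[symmetric] inv_solve_left')
  then obtain U where U: "openin X U" "x0 \<in> U" "inv\<^bsub>G\<^esub> g \<otimes>\<^bsub>G\<^esub> h \<notin> small_loop_classes X x0 U"
    using sep[of "inv\<^bsub>G\<^esub> g \<otimes>\<^bsub>G\<^esub> h"] by (auto simp: G_def[symmetric])
  interpret S: subgroup "small_loop_classes X x0 U" G
    unfolding G_def using x0 U(2) by (rule subgroup_small_loop_classes)
  let ?C = "\<lambda>g. (\<lambda>s. g \<otimes>\<^bsub>G\<^esub> s) ` small_loop_classes X x0 U"
  have "disjnt (?C g) (?C h)"
  proof (rule ccontr)
    assume "\<not> disjnt (?C g) (?C h)"
    then obtain s t where st: "s \<in> small_loop_classes X x0 U" "t \<in> small_loop_classes X x0 U"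
        "g \<otimes>\<^bsub>G\<^esub> s = h \<otimes>\<^bsub>G\<^esub> t"
      by (auto simp: disjnt_iff)
    then have "h = g \<otimes>\<^bsub>G\<^esub> (s \<otimes>\<^bsub>G\<^esub> inv\<^bsub>G\<^esub> t)"
      using gh(1,2) by (metis S.mem_carrier S.m_inv_closed inv_solve_right m_assoc m_closed)
    then have "inv\<^bsub>G\<^esub> g \<otimes>\<^bsub>G\<^esub> h = s \<otimes>\<^bsub>G\<^esub> inv\<^bsub>G\<^esub> t"
      using gh(1,2) st by (metis S.mem_carrier S.m_inv_closed inv_solve_left m_closed)
    with U(3) st show False
      by auto
  qed
  moreover have "c \<in> ?C c" if "c \<in> carrier G" for c
    using that by (auto intro!: image_eqI[of _ _ "\<one>\<^bsub>G\<^esub>"])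
  ultimately show "\<exists>A B. openin (whisker_topology X x0) A \<and> openin (whisker_topology X x0) B \<and>
      g \<in> A \<and> h \<in> B \<and> disjnt A B"
    using gh openin_small_coset[OF U(1,2), folded G_def]
    by (intro exI[of _ "?C g"] exI[of _ "?C h"]) auto
qed

lemma discrete_whisker_topologyD:
  assumes x0: "x0 \<in> topspace X"
    and "whisker_topology X x0 = discrete_topology (carrier (fundamental_group X x0))"
  obtains U where "openin X U" "x0 \<in> U" "small_loop_classes X x0 U \<subseteq> {\<one>\<^bsub>fundamental_group X x0\<^esub>}"
proof -
  interpret group "fundamental_group X x0"
    using x0 by (rule group_fundamental_group)
  have "openin (whisker_topology X x0) {\<one>\<^bsub>fundamental_group X x0\<^esub>}"
    unfolding assms(2) by simp
  then obtain U where U: "openin X U" "x0 \<in> U"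
      "\<forall>s\<in>small_loop_classes X x0 U. \<one>\<^bsub>fundamental_group X x0\<^esub> \<otimes>\<^bsub>fundamental_group X x0\<^esub> s \<in> {\<one>\<^bsub>fundamental_group X x0\<^esub>}"
    unfolding openin_whisker_topology_iff[OF x0] by blast
  interpret subgroup "small_loop_classes X x0 U" "fundamental_group X x0"
    using x0 U(2) by (rule subgroup_small_loop_classes)
  show thesis
    using U by (intro that[of U]) auto
qed

section \<open>Products of semilocally simply connected spaces\<close>

lemma loop_at_in_topspace: "\<lbrakk>loop_at X x0 p; t \<in> {0..1}\<rbrakk> \<Longrightarrow> p t \<in> topspace X"
  by (auto simp: loop_at_def pathin_def continuous_map_def Pi_iff)

lemma loop_at_product_topology_iff:
  "loop_at (product_topology Y UNIV) b p \<longleftrightarrow> (\<forall>i. loop_at (Y i) (b i) (\<lambda>t. p t i))"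
  by (auto simp: loop_at_def pathin_def continuous_map_componentwise_UNIV fun_eq_iff)

lemma concat_paths_component: "(\<lambda>t. concat_paths p q t i) = concat_paths (\<lambda>t. p t i) (\<lambda>t. q t i)"
  by (simp add: concat_paths_def fun_eq_iff)

lemma reverse_loop_component: "(\<lambda>t. reverse_loop p t i) = reverse_loop (\<lambda>t. p t i)"
  by (simp add: reverse_loop_def)

lemma loop_homotopic_product_topology_iff:
  "loop_homotopic (product_topology Y UNIV) b p q \<longleftrightarrow>
    (\<forall>i. loop_homotopic (Y i) (b i) (\<lambda>t. p t i) (\<lambda>t. q t i))" (is "?L \<longleftrightarrow> (\<forall>i. ?R i)")
proof
  let ?I = "top_of_set {0..1::real}"
  assume ?L
  then obtain h where "continuous_map (prod_topology ?I ?I) (product_topology Y UNIV) h"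
      "\<forall>x. h (0, x) = p x" "\<forall>x. h (1, x) = q x" "\<forall>t\<in>{0..1}. h (t, 0) = b \<and> h (t, 1) = b"
    unfolding loop_homotopic_def homotopic_with_def by auto
  then show "\<forall>i. ?R i"
    unfolding loop_homotopic_def homotopic_with_def
    by (intro allI, rule_tac x="\<lambda>z. h z i" in exI) (simp add: continuous_map_componentwise_UNIV)
next
  let ?I = "top_of_set {0..1::real}"
  assume "\<forall>i. ?R i"
  then have "\<forall>i. \<exists>h. continuous_map (prod_topology ?I ?I) (Y i) h \<and>
      (\<forall>x. h (0, x) = p x i) \<and> (\<forall>x. h (1, x) = q x i) \<and>
      (\<forall>t\<in>{0..1}. h (t, 0) = b i \<and> h (t, 1) = b i)"
    unfolding loop_homotopic_def homotopic_with_def by simp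
  then obtain h where "\<forall>i. continuous_map (prod_topology ?I ?I) (Y i) (h i) \<and>
      (\<forall>x. h i (0, x) = p x i) \<and> (\<forall>x. h i (1, x) = q x i) \<and>
      (\<forall>t\<in>{0..1}. h i (t, 0) = b i \<and> h i (t, 1) = b i)"
    by metis
  then show ?L
    unfolding loop_homotopic_def homotopic_with_def
    by (intro exI[of _ "\<lambda>z i. h i z"]) (auto simp: continuous_map_componentwise_UNIV fun_eq_iff)
qed

text \<open>Semilocal simple connectedness, required at the base point only. The homotopies may leave \<open>V\<close>.\<close>

definition semilocally_simply_connected_at :: "'a topology \<Rightarrow> 'a \<Rightarrow> bool" where
  "semilocally_simply_connected_at Y b \<longleftrightarrow> (\<exists>V. openin Y V \<and> b \<in> V \<and>
    (\<forall>\<eta>. loop_at Y b \<eta> \<and> \<eta> ` {0..1} \<subseteq> V \<longrightarrow> loop_homotopic Y b \<eta> (\<lambda>_. b)))"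

lemma semilocally_simply_connected_at_imp_in_topspace:
  "semilocally_simply_connected_at Y b \<Longrightarrow> b \<in> topspace Y"
  unfolding semilocally_simply_connected_at_def using openin_subset by blast

lemma loop_homotopic_conjugate_const:
  assumes p: "loop_at Y b p" and q: "loop_homotopic Y b q (\<lambda>_. b)"
  shows "loop_homotopic Y b (concat_paths (concat_paths (reverse_loop p) q) p) (\<lambda>_. b)"
proof -
  have *: "b \<in> topspace Y" "loop_at Y b q" "loop_at Y b (reverse_loop p)"
    using p q loop_at_imp_in_topspace loop_homotopic_imp_loop_at loop_at_reverse_loop by metis+
  interpret group "fundamental_group Y b"
    using *(1) by (rule group_fundamental_group)
  have "loop_class Y b q = \<one>\<^bsub>fundamental_group Y b\<^esub>"
    using q by (simp add: one_fundamental_group loop_class_eqI)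
  moreover have "loop_class Y b (reverse_loop p) \<in> carrier (fundamental_group Y b)"
    using * by (auto simp: carrier_fundamental_group)
  ultimately have "loop_class Y b (concat_paths (concat_paths (reverse_loop p) q) p) =
      \<one>\<^bsub>fundamental_group Y b\<^esub>"
    using p * loop_class_reverse_loop_mult[OF p]
    by (simp add: loop_at_concat_paths flip: mult_loop_class)
  then show ?thesis
    using p * by (simp add: one_fundamental_group loop_class_eq_iff loop_at_concat_paths)
qed

text \<open>A loop that is trivial in the finitely many coordinates restricted by \<open>U\<close> remains so after
  conjugation, and it is then homotopic to a loop in \<open>U\<close>, whatever it does in the other coordinates.\<close>

theorem topological_group_whisker_topology_product:
  assumes slsc: "\<And>i::'i. semilocally_simply_connected_at (Y i) (b i)"
  shows "topological_group (fundamental_group (product_topology Y UNIV) b)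
    (whisker_topology (product_topology Y UNIV) b)"
proof (rule topological_group_whisker_topology)
  let ?X = "product_topology Y UNIV"
  have bY: "b i \<in> topspace (Y i)" for i
    using slsc by (rule semilocally_simply_connected_at_imp_in_topspace)
  then show "b \<in> topspace ?X"
    by auto
  fix g U
  assume g: "g \<in> carrier (fundamental_group ?X b)" and U: "openin ?X U" "b \<in> U"
  obtain \<gamma> where \<gamma>: "g = loop_class ?X b \<gamma>" "loop_at ?X b \<gamma>"
    using g unfolding carrier_fundamental_group by blast
  obtain B where B: "b \<in> (\<Pi>\<^sub>E i\<in>UNIV. B i)" "\<And>i. openin (Y i) (B i)"
      "finite {i. B i \<noteq> topspace (Y i)}" "(\<Pi>\<^sub>E i\<in>UNIV. B i) \<subseteq> U"
    using product_topology_open_contains_basis[OF U] by blast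
  obtain C where C: "\<And>i. openin (Y i) (C i)" "\<And>i. b i \<in> C i"
      "\<And>i \<eta>. \<lbrakk>loop_at (Y i) (b i) \<eta>; \<eta> ` {0..1} \<subseteq> C i\<rbrakk> \<Longrightarrow> loop_homotopic (Y i) (b i) \<eta> (\<lambda>_. b i)"
    using slsc unfolding semilocally_simply_connected_at_def by metis
  define V where "V = (\<Pi>\<^sub>E i\<in>UNIV. if B i = topspace (Y i) then topspace (Y i) else C i)"
  have "openin ?X V"
    unfolding V_def openin_PiE_gen using B(3) C(1) by (auto intro: finite_subset[rotated])
  moreover have "b \<in> V"
    using bY C(2) by (auto simp: V_def)
  moreover have "inv\<^bsub>fundamental_group ?X b\<^esub> g \<otimes>\<^bsub>fundamental_group ?X b\<^esub> s
      \<otimes>\<^bsub>fundamental_group ?X b\<^esub> g \<in> small_loop_classes ?X b U"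
    if s: "s \<in> small_loop_classes ?X b V" for s
  proof -
    obtain \<eta> where \<eta>: "s = loop_class ?X b \<eta>" "loop_at ?X b \<eta>" "\<eta> ` {0..1} \<subseteq> V"
      using s unfolding small_loop_classes_def by blast
    define \<theta> where "\<theta> = concat_paths (concat_paths (reverse_loop \<gamma>) \<eta>) \<gamma>"
    have \<theta>: "loop_at ?X b \<theta>"
      "inv\<^bsub>fundamental_group ?X b\<^esub> g \<otimes>\<^bsub>fundamental_group ?X b\<^esub> s
        \<otimes>\<^bsub>fundamental_group ?X b\<^esub> g = loop_class ?X b \<theta>"
      using \<gamma> \<eta> by (simp_all add: \<theta>_def inv_loop_class mult_loop_class loop_at_concat_paths
          loop_at_reverse_loop)
    \<comment> \<open>In the coordinates where \<open>U\<close> imposes a condition, \<open>\<eta>\<close> and hence \<open>\<theta>\<close> is nullhomotopic, so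
      \<open>\<theta>\<close> can be replaced by the constant loop there.\<close>
    define \<theta>' where "\<theta>' = (\<lambda>t i. if B i = topspace (Y i) then \<theta> t i else b i)"
    have "loop_homotopic (Y i) (b i) (\<lambda>t. \<theta> t i) (\<lambda>t. \<theta>' t i)" for i
    proof (cases "B i = topspace (Y i)")
      case True
      then show ?thesis
        using \<theta>(1) by (simp add: \<theta>'_def loop_homotopic_refl loop_at_product_topology_iff)
    next
      case False
      have "loop_homotopic (Y i) (b i) (\<lambda>t. \<eta> t i) (\<lambda>_. b i)"
      proof (rule C(3))
        show "loop_at (Y i) (b i) (\<lambda>t. \<eta> t i)"
          using \<eta>(2) by (simp add: loop_at_product_topology_iff)
        have "\<eta> t i \<in> C i" if "t \<in> {0..1}" for t
        proof -
          have "\<eta> t \<in> V"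
            using \<eta>(3) that by blast
          then have "\<eta> t i \<in> (if B i = topspace (Y i) then topspace (Y i) else C i)"
            unfolding V_def by (rule PiE_mem) simp
          with False show ?thesis
            by simp
        qed
        then show "(\<lambda>t. \<eta> t i) ` {0..1} \<subseteq> C i"
          by blast
      qed
      then show ?thesis
        using False loop_homotopic_conjugate_const[of "Y i" "b i" "\<lambda>t. \<gamma> t i"] \<gamma>(2)
        by (simp add: \<theta>_def \<theta>'_def concat_paths_component reverse_loop_component
            loop_at_product_topology_iff)
    qed
    then have hom: "loop_homotopic ?X b \<theta> \<theta>'"
      by (simp add: loop_homotopic_product_topology_iff)
    have "loop_class ?X b \<theta> = loop_class ?X b \<theta>'"
      using hom by (rule loop_class_eqI)
    moreover have "loop_at ?X b \<theta>'"
      using loop_homotopic_imp_loop_at[OF hom] by (rule conjunct2)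
    moreover have "\<theta>' t \<in> U" if t: "t \<in> {0..1}" for t
    proof -
      have "\<theta> t i \<in> topspace (Y i)" for i
        using loop_at_in_topspace[OF \<theta>(1) t] by auto
      then have "\<theta>' t \<in> (\<Pi>\<^sub>E i\<in>UNIV. B i)"
        using B(1) by (auto simp: \<theta>'_def)
      with B(4) show ?thesis
        by blast
    qed
    ultimately show ?thesis
      unfolding \<theta>(2) small_loop_classes_def by blast
  qed
  ultimately show "\<exists>V. openin ?X V \<and> b \<in> V \<and> (\<forall>s\<in>small_loop_classes ?X b V.
      inv\<^bsub>fundamental_group ?X b\<^esub> g \<otimes>\<^bsub>fundamental_group ?X b\<^esub> s
        \<otimes>\<^bsub>fundamental_group ?X b\<^esub> g \<in> small_loop_classes ?X b U)"
    by blast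
qed

text \<open>A nontrivial class is nontrivial in some coordinate \<open>i\<close>, and it cannot be represented by a loop
  whose \<open>i\<close>-th coordinate stays in a neighbourhood with only nullhomotopic loops.\<close>

theorem Hausdorff_space_whisker_topology_product:
  assumes slsc: "\<And>i::'i. semilocally_simply_connected_at (Y i) (b i)"
  shows "Hausdorff_space (whisker_topology (product_topology Y UNIV) b)"
proof (rule Hausdorff_space_whisker_topology)
  let ?X = "product_topology Y UNIV"
  show b: "b \<in> topspace ?X"
    using semilocally_simply_connected_at_imp_in_topspace[OF slsc] by auto
  fix g assume g: "g \<in> carrier (fundamental_group ?X b)" "g \<noteq> \<one>\<^bsub>fundamental_group ?X b\<^esub>"
  then obtain \<gamma> where \<gamma>: "g = loop_class ?X b \<gamma>" "loop_at ?X b \<gamma>"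
    unfolding carrier_fundamental_group by blast
  then have "\<not> loop_homotopic ?X b \<gamma> (\<lambda>_. b)"
    using g(2) by (auto simp: one_fundamental_group loop_class_eqI)
  then obtain i where i: "\<not> loop_homotopic (Y i) (b i) (\<lambda>t. \<gamma> t i) (\<lambda>_. b i)"
    unfolding loop_homotopic_product_topology_iff by blast
  obtain C where C: "openin (Y i) C" "b i \<in> C"
      "\<And>\<eta>. \<lbrakk>loop_at (Y i) (b i) \<eta>; \<eta> ` {0..1} \<subseteq> C\<rbrakk> \<Longrightarrow> loop_homotopic (Y i) (b i) \<eta> (\<lambda>_. b i)"
    using slsc[of i] unfolding semilocally_simply_connected_at_def by blast
  have "openin ?X {x \<in> topspace ?X. x i \<in> C}"
    using C(1) by (intro openin_continuous_map_preimage[of _ "Y i"])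
      (auto simp: continuous_map_product_projection)
  moreover have "g \<notin> small_loop_classes ?X b {x \<in> topspace ?X. x i \<in> C}"
  proof
    assume "g \<in> small_loop_classes ?X b {x \<in> topspace ?X. x i \<in> C}"
    then obtain \<eta> where \<eta>: "g = loop_class ?X b \<eta>" "loop_at ?X b \<eta>"
        "\<eta> ` {0..1} \<subseteq> {x \<in> topspace ?X. x i \<in> C}"
      unfolding small_loop_classes_def by blast
    have "loop_homotopic (Y i) (b i) (\<lambda>t. \<eta> t i) (\<lambda>_. b i)"
      using \<eta>(2,3) by (intro C(3)) (auto simp: loop_at_product_topology_iff)
    moreover have "loop_homotopic (Y i) (b i) (\<lambda>t. \<gamma> t i) (\<lambda>t. \<eta> t i)"
      using loop_class_eq_iff[OF \<gamma>(2), of \<eta>] \<gamma>(1) \<eta>(1)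
      by (simp add: loop_homotopic_product_topology_iff)
    ultimately show False
      using i loop_homotopic_trans by metis
  qed
  ultimately show "\<exists>U. openin ?X U \<and> b \<in> U \<and> g \<notin> small_loop_classes ?X b U"
    using b C(2) by blast
qed

definition insert_loop :: "('i \<Rightarrow> 'a) \<Rightarrow> 'i \<Rightarrow> (real \<Rightarrow> 'a) \<Rightarrow> real \<Rightarrow> 'i \<Rightarrow> 'a" where
  "insert_loop b n p = (\<lambda>t. b(n := p t))"

lemma loop_at_insert_loop:
  assumes "b \<in> topspace (product_topology Y UNIV)" "loop_at (Y n) (b n) p"
  shows "loop_at (product_topology Y UNIV) b (insert_loop b n p)"
  unfolding loop_at_product_topology_iff
proof
  fix i
  have "b i \<in> topspace (Y i)"
    using assms(1) by auto
  then show "loop_at (Y i) (b i) (\<lambda>t. insert_loop b n p t i)"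
    using assms(2) by (cases "i = n") (simp_all add: insert_loop_def loop_at_const)
qed

text \<open>A neighbourhood of the base point leaves all but finitely many coordinates free, so it contains
  an essential loop that moves only in a free coordinate.\<close>

theorem whisker_topology_product_not_discrete:
  assumes b: "\<And>i. b i \<in> topspace (Y i)" and inf: "infinite (UNIV :: 'i set)"
    and p: "\<And>i::'i. loop_at (Y i) (b i) (p i) \<and> \<not> loop_homotopic (Y i) (b i) (p i) (\<lambda>_. b i)"
  shows "whisker_topology (product_topology Y UNIV) b \<noteq>
    discrete_topology (carrier (fundamental_group (product_topology Y UNIV) b))"
proof
  let ?X = "product_topology Y UNIV"
  have bX: "b \<in> topspace ?X"
    using b by auto
  assume "whisker_topology ?X b = discrete_topology (carrier (fundamental_group ?X b))"
  then obtain U where U: "openin ?X U" "b \<in> U" "small_loop_classes ?X b U \<subseteq> {\<one>\<^bsub>fundamental_group ?X b\<^esub>}"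
    using discrete_whisker_topologyD[OF bX] by blast
  obtain B where B: "b \<in> (\<Pi>\<^sub>E i\<in>UNIV. B i)" "finite {i. B i \<noteq> topspace (Y i)}" "(\<Pi>\<^sub>E i\<in>UNIV. B i) \<subseteq> U"
    using product_topology_open_contains_basis[OF U(1,2)] by blast
  obtain n where n: "B n = topspace (Y n)"
    using B(2) inf by (metis (mono_tags, lifting) UNIV_eq_I mem_Collect_eq)
  have loop: "loop_at ?X b (insert_loop b n (p n))"
    using bX p by (intro loop_at_insert_loop) auto
  have "insert_loop b n (p n) t \<in> (\<Pi>\<^sub>E i\<in>UNIV. B i)" if "t \<in> {0..1}" for t
    using that B(1) n p[of n] loop_at_in_topspace[of "Y n" "b n" "p n" t]
    by (auto simp: insert_loop_def)
  then have "loop_class ?X b (insert_loop b n (p n)) \<in> small_loop_classes ?X b U"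
    using loop B(3) unfolding small_loop_classes_def by blast
  then have "loop_homotopic ?X b (insert_loop b n (p n)) (\<lambda>_. b)"
    using U(3) loop by (auto simp: one_fundamental_group loop_class_eq_iff)
  then have "loop_homotopic (Y n) (b n) (p n) (\<lambda>_. b n)"
    unfolding loop_homotopic_product_topology_iff by (auto simp: insert_loop_def dest: spec[of _ n])
  with p show False
    by blast
qed

section \<open>Commutators of loops\<close>

text \<open>The bracketing makes the commutator of two circles wrap the four sides of a rectangle in the
  parametrization of \<^const>\<open>rectpath\<close>.\<close>

definition commutator_loop :: "(real \<Rightarrow> 'a) \<Rightarrow> (real \<Rightarrow> 'a) \<Rightarrow> real \<Rightarrow> 'a" where
  "commutator_loop p q =
    concat_paths p (concat_paths q (concat_paths (reverse_loop p) (reverse_loop q)))"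

lemma loop_at_commutator_loop:
  "\<lbrakk>loop_at X x0 p; loop_at X x0 q\<rbrakk> \<Longrightarrow> loop_at X x0 (commutator_loop p q)"
  unfolding commutator_loop_def by (intro loop_at_concat_paths loop_at_reverse_loop)

lemma loop_homotopic_commutator_loop:
  assumes "comm_group (fundamental_group X x0)" and p: "loop_at X x0 p" and q: "loop_at X x0 q"
  shows "loop_homotopic X x0 (commutator_loop p q) (\<lambda>_. x0)"
proof -
  define G where "G = fundamental_group X x0"
  interpret comm_group G
    using assms(1) unfolding G_def .
  define P Q where "P = loop_class X x0 p" and "Q = loop_class X x0 q"
  have [simp]: "P \<in> carrier G" "Q \<in> carrier G"
    using p q by (auto simp: G_def P_def Q_def carrier_fundamental_group)
  have "loop_class X x0 (commutator_loop p q) = P \<otimes>\<^bsub>G\<^esub> (Q \<otimes>\<^bsub>G\<^esub> (inv\<^bsub>G\<^esub> P \<otimes>\<^bsub>G\<^esub> inv\<^bsub>G\<^esub> Q))"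
    using p q by (simp add: G_def P_def Q_def commutator_loop_def inv_loop_class mult_loop_class
        loop_at_concat_paths loop_at_reverse_loop)
  also have "\<dots> = (P \<otimes>\<^bsub>G\<^esub> Q) \<otimes>\<^bsub>G\<^esub> inv\<^bsub>G\<^esub> (P \<otimes>\<^bsub>G\<^esub> Q)"
    by (simp add: inv_mult m_assoc)
  also have "\<dots> = \<one>\<^bsub>G\<^esub>"
    by (simp add: r_inv)
  finally show ?thesis
    using p q by (simp add: G_def one_fundamental_group loop_class_eq_iff loop_at_commutator_loop)
qed

theorem fundamental_group_product_not_comm:
  assumes b: "b \<in> topspace (product_topology Y UNIV)"
    and p: "loop_at (Y n) (b n) p" and q: "loop_at (Y n) (b n) q"
    and nontrivial: "\<not> loop_homotopic (Y n) (b n) (commutator_loop p q) (\<lambda>_. b n)"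
  shows "\<not> comm_group (fundamental_group (product_topology Y UNIV) b)"
proof
  let ?X = "product_topology Y UNIV"
  assume "comm_group (fundamental_group ?X b)"
  then have "loop_homotopic ?X b (commutator_loop (insert_loop b n p) (insert_loop b n q)) (\<lambda>_. b)"
    using b p q by (intro loop_homotopic_commutator_loop loop_at_insert_loop)
  then have "loop_homotopic (Y n) (b n)
      (\<lambda>t. commutator_loop (insert_loop b n p) (insert_loop b n q) t n) (\<lambda>_. b n)"
    unfolding loop_homotopic_product_topology_iff by blast
  moreover have "(\<lambda>t. commutator_loop (insert_loop b n p) (insert_loop b n q) t n) = commutator_loop p q"
    by (simp add: commutator_loop_def concat_paths_component reverse_loop_component)
      (simp add: insert_loop_def)
  ultimately show False
    using nontrivial by simp
qed

section \<open>Lifting homotopies in the circle to the line\<close>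

lemma cis_two_pi_eq_1_iff: "cis (2 * pi * x) = 1 \<longleftrightarrow> x \<in> \<int>"
proof
  assume "cis (2 * pi * x) = 1"
  then have "cos (2 * pi * x) = 1"
    by (metis cis.sel(1) one_complex.sel(1))
  then obtain n :: int where "2 * pi * x = of_int n * 2 * pi"
    unfolding cos_one_2pi_int by blast
  then have "x = of_int n"
    by simp
  then show "x \<in> \<int>"
    by simp
qed (rule cis_multiple_2pi)

lemma continuous_on_Ints_valued_constant:
  fixes f :: "'a::topological_space \<Rightarrow> real"
  assumes "connected S" "continuous_on S f" "\<And>x. x \<in> S \<Longrightarrow> f x \<in> \<int>" and "x \<in> S" "y \<in> S"
  shows "f x = f y"
proof -
  have "f constant_on S"
  proof (rule continuous_discrete_range_constant[OF assms(1,2)])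
    fix x assume x: "x \<in> S"
    have "1 \<le> norm (f y - f x)" if "y \<in> S" "f y \<noteq> f x" for y
      using that x assms(3) Ints_nonzero_abs_ge1[of "f y - f x"] by (simp add: Ints_diff)
    then show "\<exists>e>0. \<forall>y. y \<in> S \<and> f y \<noteq> f x \<longrightarrow> e \<le> norm (f y - f x)"
      by (intro exI[of _ 1]) auto
  qed
  then show ?thesis
    using assms(4,5) by (auto simp: constant_on_def)
qed

text \<open>This is the lifting of a homotopy along the covering \<open>x \<mapsto> exp(2 \<pi> i x)\<close>, with control over the
  boundary of the square. The lift comes from a logarithm, which exists because the square is
  contractible; on each side of the square it differs from the prescribed value by a continuous
  function with integer values, that is, by a constant.\<close>

lemma circle_homotopy_lift:
  fixes H :: "real \<times> real \<Rightarrow> complex"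
  assumes cont: "continuous_on ({0..1} \<times> {0..1}) H"
    and norm: "\<And>z. z \<in> {0..1} \<times> {0..1} \<Longrightarrow> norm (H z) = 1"
    and start: "\<And>t. t \<in> {0..1} \<Longrightarrow> H (0, t) = 1"
    and sides: "\<And>s. s \<in> {0..1} \<Longrightarrow> H (s, 0) = 1 \<and> H (s, 1) = 1"
    and final: "\<And>t. t \<in> {0..1} \<Longrightarrow> H (1, t) = cis (2 * pi * \<rho> t)"
    and \<rho>: "continuous_on {0..1} \<rho>" "\<rho> 0 = 0"
  obtains x where "continuous_on ({0..1} \<times> {0..1}) x"
    "\<And>z. z \<in> {0..1} \<times> {0..1} \<Longrightarrow> H z = cis (2 * pi * x z)"
    "\<And>t. t \<in> {0..1} \<Longrightarrow> x (0, t) = 0"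
    "\<And>s. s \<in> {0..1} \<Longrightarrow> x (s, 0) = 0 \<and> x (s, 1) = 0"
    "\<And>t. t \<in> {0..1} \<Longrightarrow> x (1, t) = \<rho> t"
proof -
  let ?Q = "{0..1} \<times> {0..1} :: (real \<times> real) set"
  have "contractible ?Q"
    by (intro convex_imp_contractible convex_Times) auto
  moreover have "H z \<noteq> 0" if "z \<in> ?Q" for z
    using norm[OF that] by auto
  ultimately obtain g where g: "continuous_on ?Q g" "\<And>z. z \<in> ?Q \<Longrightarrow> H z = exp (g z)"
    using continuous_logarithm_on_contractible[OF cont] by metis
  define x where "x = (\<lambda>z. (Im (g z) - Im (g (0, 0))) / (2 * pi))"
  have cx: "continuous_on ?Q x"
    unfolding x_def by (intro continuous_intros g(1)) auto
  have H: "H z = cis (Im (g z))" if z: "z \<in> ?Q" for z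
  proof -
    have "Re (g z) = 0"
      using norm[OF z] g(2)[OF z] by (simp add: norm_exp_eq_Re)
    then show ?thesis
      using g(2)[OF z] by (simp add: exp_eq_polar)
  qed
  have Hx: "H z = cis (2 * pi * x z)" if z: "z \<in> ?Q" for z
  proof -
    have "cis (2 * pi * x z) = cis (Im (g z)) / cis (Im (g (0, 0)))"
      by (simp add: x_def cis_divide)
    also have "\<dots> = H z / H (0, 0)"
      using z H[of "(0, 0)"] H[of z] by simp
    finally show ?thesis
      using start[of 0] by simp
  qed
  have x00: "x (0, 0) = 0"
    by (simp add: x_def)
  have const: "f t = f u" if "continuous_on {0..1} f" "\<And>t. t \<in> {0..1} \<Longrightarrow> cis (2 * pi * f t) = 1"
      "t \<in> {0..1}" "u \<in> {0..1}" for f :: "real \<Rightarrow> real" and t u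
    using that by (intro continuous_on_Ints_valued_constant[of "{0..1}" f])
      (simp_all add: cis_two_pi_eq_1_iff)
  have c1: "continuous_on {0..1} (\<lambda>t. x (s, t))" if "s \<in> {0..1}" for s
    by (rule continuous_on_compose2[OF cx]) (use that in \<open>auto intro!: continuous_intros\<close>)
  have c2: "continuous_on {0..1} (\<lambda>s. x (s, t))" if "t \<in> {0..1}" for t
    by (rule continuous_on_compose2[OF cx]) (use that in \<open>auto intro!: continuous_intros\<close>)
  have x0: "x (0, t) = 0" if "t \<in> {0..1}" for t
    using const[OF c1[of 0], of t 0] that start Hx[of "(0, _)"] x00 by simp
  have xs: "x (s, 0) = 0" "x (s, 1) = 0" if "s \<in> {0..1}" for s
    using const[OF c2[of 0], of s 0] const[OF c2[of 1], of s 0] that sides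
      Hx[of "(_, 0)"] Hx[of "(_, 1)"] x0[of 0] x0[of 1] by simp_all
  have x1: "x (1, t) = \<rho> t" if t: "t \<in> {0..1}" for t
  proof -
    have "x (1, t) - \<rho> t = x (1, 0) - \<rho> 0"
    proof (rule const[of "\<lambda>t. x (1, t) - \<rho> t"])
      show "continuous_on {0..1} (\<lambda>t. x (1, t) - \<rho> t)"
        by (intro continuous_intros c1 \<rho>) auto
      show "cis (2 * pi * (x (1, t) - \<rho> t)) = 1" if "t \<in> {0..1}" for t
        using that final[of t] Hx[of "(1, t)"]
        by (simp add: right_diff_distrib cis_divide[symmetric])
    qed (use t in auto)
    then show ?thesis
      using xs(1)[of 1] \<rho>(2) by simp
  qed
  show thesis
    by (rule that[of x]) (use cx Hx x0 xs x1 in auto)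
qed

section \<open>The wedge of two circles\<close>

definition circle_incl :: "bool \<Rightarrow> complex \<Rightarrow> (bool \<times> complex) set" where
  "circle_incl j z = wedge_proj (\<lambda>_. 1) UNIV (j, z)"

text \<open>The retraction onto circle \<open>j\<close>, which collapses the other one. The points of the wedge are
  equivalence classes; any representative gives the same value, since all representatives of the
  wedge point are sent to \<open>1\<close>.\<close>

definition circle_retr :: "bool \<Rightarrow> (bool \<times> complex) set \<Rightarrow> complex" where
  "circle_retr j y = (case SOME w. w \<in> y of (k, z) \<Rightarrow> if k = j then z else 1)"

lemma circle_retr_incl: "circle_retr j (circle_incl k z) = (if k = j then z else 1)"
proof (cases "z = 1")
  case True
  then have eq: "circle_incl k z = (\<lambda>i. (i, 1)) ` UNIV"
    by (auto simp: circle_incl_def wedge_proj_def wedge_point_def)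
  then have "\<exists>w. w \<in> circle_incl k z"
    by blast
  then have "(SOME w. w \<in> circle_incl k z) \<in> circle_incl k z"
    by (rule someI_ex)
  then obtain i where "(SOME w. w \<in> circle_incl k z) = (i, 1)"
    unfolding eq by blast
  then show ?thesis
    using True by (simp add: circle_retr_def)
next
  case False
  then have "circle_incl k z = {(k, z)}"
    by (auto simp: circle_incl_def wedge_proj_def wedge_point_def)
  then show ?thesis
    by (simp add: circle_retr_def)
qed

lemma circle_incl_1: "circle_incl j 1 = two_circles_point"
  by (auto simp: circle_incl_def two_circles_point_def wedge_proj_def wedge_point_def)

lemma circle_retr_point: "circle_retr j two_circles_point = 1"
  by (metis circle_incl_1 circle_retr_incl)

lemma quotient_map_two_circles:
  "quotient_map (sum_topology (\<lambda>_. top_of_set (sphere 0 1)) UNIV) two_circles (wedge_proj (\<lambda>_. 1) UNIV)"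
  unfolding two_circles_def wedge_sum_def by (rule quotient_map_quotient_topology)

lemma topspace_two_circles: "topspace two_circles = (\<Union>j. circle_incl j ` sphere 0 1)"
  by (auto simp: two_circles_def wedge_sum_def circle_incl_def image_iff)

lemma continuous_map_circle_incl: "continuous_map (top_of_set (sphere 0 1)) two_circles (circle_incl j)"
proof -
  have "continuous_map (top_of_set (sphere 0 1)) two_circles (wedge_proj (\<lambda>_. 1) UNIV \<circ> (\<lambda>z. (j, z)))"
    using continuous_map_component_injection[of j UNIV "\<lambda>_. top_of_set (sphere 0 1 :: complex set)"]
      quotient_imp_continuous_map[OF quotient_map_two_circles]
    by (intro continuous_map_compose) auto
  moreover have "wedge_proj (\<lambda>_. 1) UNIV \<circ> (\<lambda>z. (j, z)) = circle_incl j"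
    by (simp add: fun_eq_iff circle_incl_def)
  ultimately show ?thesis
    by simp
qed

lemma continuous_map_circle_retr: "continuous_map two_circles (top_of_set (sphere 0 1)) (circle_retr j)"
proof (rule continuous_compose_quotient_map[OF quotient_map_two_circles])
  have *: "(circle_retr j \<circ> wedge_proj (\<lambda>_. 1) UNIV) (k, z) = (if k = j then z else 1)" for k z
    using circle_retr_incl by (simp add: circle_incl_def)
  show "continuous_map (sum_topology (\<lambda>_. top_of_set (sphere 0 1)) UNIV) (top_of_set (sphere 0 1))
      (circle_retr j \<circ> wedge_proj (\<lambda>_. 1) UNIV)"
    unfolding continuous_map_def
  proof (intro conjI allI impI)
    show "circle_retr j \<circ> wedge_proj (\<lambda>_. 1) UNIV
        \<in> topspace (sum_topology (\<lambda>_. top_of_set (sphere 0 1)) UNIV) \<rightarrow> topspace (top_of_set (sphere 0 1))"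
      unfolding Pi_iff using * by auto
    fix U :: "complex set" assume U: "openin (top_of_set (sphere 0 1)) U"
    let ?f = "circle_retr j \<circ> wedge_proj (\<lambda>_. 1) UNIV"
    let ?P = "{w \<in> topspace (sum_topology (\<lambda>_. top_of_set (sphere 0 1)) UNIV). ?f w \<in> U}"
    have "openin (top_of_set (sphere 0 1)) {z. (k, z) \<in> ?P}" for k
    proof -
      have "{z. (k, z) \<in> ?P} = (if k = j then U else if 1 \<in> U then sphere 0 1 else {})"
        using * openin_subset[OF U] by auto
      then show ?thesis
        using U by simp
    qed
    then show "openin (sum_topology (\<lambda>_. top_of_set (sphere 0 1)) UNIV) ?P"
      unfolding openin_sum_topology by auto
  qed
qed

lemma norm_circle_retr: "y \<in> topspace two_circles \<Longrightarrow> norm (circle_retr j y) = 1"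
  by (auto simp: topspace_two_circles circle_retr_incl)

lemma circle_retr_eq_1_cases:
  "y \<in> topspace two_circles \<Longrightarrow> circle_retr True y = 1 \<or> circle_retr False y = 1"
  by (auto simp: topspace_two_circles circle_retr_incl)

lemma circle_incl_retr:
  "\<lbrakk>y \<in> topspace two_circles; circle_retr (\<not> j) y = 1\<rbrakk> \<Longrightarrow> circle_incl j (circle_retr j y) = y"
  by (auto simp: topspace_two_circles circle_retr_incl circle_incl_1 split: if_splits)

lemma two_circles_point_in_topspace: "two_circles_point \<in> topspace two_circles"
  using circle_incl_1[of True] by (auto simp: topspace_two_circles intro!: image_eqI[of _ _ 1])

text \<open>The two open right half circles form a neighbourhood of the wedge point. Each contracts along
  \<open>sgn ((1 - s) z + s)\<close>, the segment from \<open>z\<close> to \<open>1\<close> projected radially to the circle; the segment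
  avoids \<open>0\<close> since \<open>Re z > 0\<close>.\<close>

lemma semilocally_simply_connected_at_two_circles:
  "semilocally_simply_connected_at two_circles two_circles_point"
proof -
  let ?S = "top_of_set (sphere 0 1 :: complex set)" and ?I = "top_of_set {0..1::real}"
  define V where "V = {y \<in> topspace two_circles. circle_retr True y \<in> {z \<in> sphere 0 1. Re z > 0}}
    \<inter> {y \<in> topspace two_circles. circle_retr False y \<in> {z \<in> sphere 0 1. Re z > 0}}"
  have "{z \<in> sphere 0 1. Re z > 0} = sphere 0 1 \<inter> {z. Re z > 0}"
    by auto
  then have "openin ?S {z \<in> sphere 0 1. Re z > 0}"
    using open_halfspace_Re_gt[of 0] by (auto intro: openin_open_Int)
  then have "openin two_circles V"
    unfolding V_def
    by (intro openin_Int openin_continuous_map_preimage[OF continuous_map_circle_retr])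
  moreover have "two_circles_point \<in> V"
    by (simp add: V_def two_circles_point_in_topspace circle_retr_point)
  moreover have "loop_homotopic two_circles two_circles_point \<eta> (\<lambda>_. two_circles_point)"
    if \<eta>: "loop_at two_circles two_circles_point \<eta>" "\<eta> ` {0..1} \<subseteq> V" for \<eta>
  proof -
    define u where "u = (\<lambda>j t. circle_retr j (\<eta> t))"
    define c where "c = (\<lambda>s z. sgn (of_real (1 - s) * z + of_real s) :: complex)"
    \<comment> \<open>One of the coordinates is always \<open>1\<close>, so comparing their distances to \<open>1\<close> tells which circle
      contains \<open>\<eta> t\<close>, and it splits the square into two closed pieces.\<close>
    define h where "h = (\<lambda>(s, t). if norm (u False t - 1) \<le> norm (u True t - 1)
      then circle_incl True (c s (u True t)) else circle_incl False (c s (u False t)))"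
    have \<eta>V: "\<eta> t \<in> V" "\<eta> t \<in> topspace two_circles" if "t \<in> {0..1}" for t
    proof -
      show "\<eta> t \<in> V"
        using \<eta>(2) imageI[OF that] by (rule subsetD)
      then show "\<eta> t \<in> topspace two_circles"
        by (simp add: V_def)
    qed
    have u: "norm (u j t) = 1" "Re (u j t) > 0" if "t \<in> {0..1}" for j t
      using \<eta>V[OF that] by (cases j; simp add: u_def norm_circle_retr V_def)+
    have cu: "continuous_on {0..1} (u j)" for j
    proof -
      have "continuous_map ?I ?S (circle_retr j \<circ> \<eta>)"
        using \<eta>(1) continuous_map_circle_retr
        by (intro continuous_map_compose) (auto simp: loop_at_def pathin_def)
      then show ?thesis
        by (simp add: u_def o_def)
    qed
    have cu2: "continuous_on ({0..1} \<times> {0..1}) (\<lambda>z::real \<times> real. u j (snd z))" for j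
      by (rule continuous_on_compose2[OF cu]) (auto intro!: continuous_intros)
    have pos: "of_real (1 - s) * u j t + of_real s \<noteq> 0" if "s \<in> {0..1}" "t \<in> {0..1}" for s t j
    proof -
      have "Re (of_real (1 - s) * u j t + of_real s) > 0"
        using that u(2)[of t j] by (cases "s = 1") (auto intro!: add_pos_nonneg mult_pos_pos)
      then show ?thesis
        by (metis less_irrefl zero_complex.sel(1))
    qed
    have ci: "continuous_map (prod_topology ?I ?I) two_circles
        (\<lambda>z. circle_incl j (c (fst z) (u j (snd z))))" for j
    proof (rule continuous_map_compose[OF _ continuous_map_circle_incl, of _ "\<lambda>z. c (fst z) (u j (snd z))",
          unfolded o_def])
      show "continuous_map (prod_topology ?I ?I) ?S (\<lambda>z. c (fst z) (u j (snd z)))"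
        unfolding prod_topology_subtopology_eu c_def
        using pos by (auto simp: norm_sgn intro!: continuous_intros cu2)
    qed
    have cn: "continuous_map (prod_topology ?I ?I) euclideanreal (\<lambda>z. norm (u j (snd z) - 1))" for j
      unfolding prod_topology_subtopology_eu by (auto intro!: continuous_intros cu2)
    have one: "u True t = 1 \<or> u False t = 1" if "t \<in> {0..1}" for t
      using \<eta>V[OF that] circle_retr_eq_1_cases by (auto simp: u_def)
    have c1: "c s 1 = 1" for s
      by (simp add: c_def)
    have "continuous_map (prod_topology ?I ?I) two_circles (\<lambda>z.
        if norm (u False (snd z) - 1) \<le> norm (u True (snd z) - 1)
        then circle_incl True (c (fst z) (u True (snd z)))
        else circle_incl False (c (fst z) (u False (snd z))))"
    proof (rule continuous_map_cases_le)
      fix z assume "z \<in> topspace (prod_topology ?I ?I)"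
        "norm (u False (snd z) - 1) = norm (u True (snd z) - 1)"
      then have "u True (snd z) = 1" "u False (snd z) = 1"
        using one[of "snd z"] by (auto simp: mem_Times_iff)
      then show "circle_incl True (c (fst z) (u True (snd z))) = circle_incl False (c (fst z) (u False (snd z)))"
        by (simp add: c1 circle_incl_1)
    qed (intro cn continuous_map_from_subtopology ci)+
    then have "continuous_map (prod_topology ?I ?I) two_circles h"
      by (simp add: h_def case_prod_unfold)
    moreover have "h (0, t) = \<eta> t" if t: "t \<in> {0..1}" for t
    proof (cases "norm (u False t - 1) \<le> norm (u True t - 1)")
      case True
      then have "u False t = 1"
        using one[OF t] by auto
      then show ?thesis
        using True u(1)[OF t, of True] \<eta>V[OF t] circle_incl_retr[of "\<eta> t" True]
        by (simp add: h_def c_def u_def sgn_eq)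
    next
      case False
      then have "u True t = 1"
        using one[OF t] by auto
      then show ?thesis
        using False u(1)[OF t, of False] \<eta>V[OF t] circle_incl_retr[of "\<eta> t" False]
        by (simp add: h_def c_def u_def sgn_eq)
    qed
    moreover have "h (1, t) = two_circles_point" for t
      by (simp add: h_def c_def circle_incl_1)
    moreover have "h (s, 0) = two_circles_point" "h (s, 1) = two_circles_point" for s
      using \<eta>(1) by (simp_all add: h_def u_def loop_at_def circle_retr_point c1 circle_incl_1)
    ultimately show ?thesis
      unfolding loop_homotopic_def
      by (subst homotopic_with) (auto simp: intro!: exI[of _ h])
  qed
  ultimately show ?thesis
    unfolding semilocally_simply_connected_at_def by blast
qed

section \<open>The commutator of the two circles\<close>

definition circle_loop :: "bool \<Rightarrow> real \<Rightarrow> (bool \<times> complex) set" where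
  "circle_loop j t = circle_incl j (cis (2 * pi * t))"

lemma loop_at_circle_loop: "loop_at two_circles two_circles_point (circle_loop j)"
proof -
  have "continuous_map (top_of_set {0..1}) two_circles (circle_incl j \<circ> (\<lambda>t. cis (2 * pi * t)))"
    by (intro continuous_map_compose[OF _ continuous_map_circle_incl])
      (auto intro!: continuous_intros)
  then show ?thesis
    by (simp add: loop_at_def pathin_def circle_loop_def[abs_def] o_def circle_incl_1)
qed

text \<open>The commutator lifts to the boundary of the unit square: the first circle is traversed along the
  horizontal sides and the second one along the vertical sides.\<close>

lemma circle_retr_commutator_loop:
  fixes t :: real
  shows "circle_retr True (commutator_loop (circle_loop True) (circle_loop False) t) =
      cis (2 * pi * Re (rectpath 0 (Complex 1 1) t))"
    "circle_retr False (commutator_loop (circle_loop True) (circle_loop False) t) =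
      cis (2 * pi * Im (rectpath 0 (Complex 1 1) t))"
  by (simp_all add: commutator_loop_def concat_paths_def reverse_loop_def circle_loop_def
      circle_retr_incl rectpath_def joinpaths_def linepath_def Let_def)

text \<open>The coordinates of the lifted homotopy cannot both be half-integers, since one of the two
  retractions is \<open>1\<close> at each point. So the centre of the unit square is never hit, and the winding
  number about it would be preserved.\<close>

theorem commutator_circle_loops_not_nullhomotopic:
  "\<not> loop_homotopic two_circles two_circles_point
    (commutator_loop (circle_loop True) (circle_loop False)) (\<lambda>_. two_circles_point)"
proof
  let ?c = "commutator_loop (circle_loop True) (circle_loop False)"
  let ?Q = "{0..1} \<times> {0..1} :: (real \<times> real) set" and ?I = "top_of_set {0..1::real}"
  let ?r = "rectpath 0 (Complex 1 1)" and ?m = "Complex (1/2) (1/2)"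
  assume "loop_homotopic two_circles two_circles_point ?c (\<lambda>_. two_circles_point)"
  then have "loop_homotopic two_circles two_circles_point (\<lambda>_. two_circles_point) ?c"
    by (rule loop_homotopic_sym)
  then obtain h where h: "continuous_map (prod_topology ?I ?I) two_circles h"
      "\<And>t. h (0, t) = two_circles_point" "\<And>t. h (1, t) = ?c t"
      "\<And>s. s \<in> {0..1} \<Longrightarrow> h (s, 0) = two_circles_point \<and> h (s, 1) = two_circles_point"
    unfolding loop_homotopic_def homotopic_with_def by auto
  have hQ: "h z \<in> topspace two_circles" if "z \<in> ?Q" for z
    using continuous_map_image_subset_topspace[OF h(1)] that by (auto simp: image_subset_iff)
  have ch: "continuous_on ?Q (\<lambda>z. circle_retr j (h z))" for j
    using continuous_map_compose[OF h(1) continuous_map_circle_retr[of j]]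
    by (simp add: prod_topology_subtopology_eu o_def)
  have cr: "continuous_on {0..1} ?r"
    using path_rectpath[of 0 "Complex 1 1"] by (simp add: path_def)
  have r0: "?r 0 = 0"
    using pathstart_rectpath[of 0 "Complex 1 1"] by (simp add: pathstart_def)
  obtain x where x: "continuous_on ?Q x"
      "\<And>z. z \<in> ?Q \<Longrightarrow> circle_retr True (h z) = cis (2 * pi * x z)"
      "\<And>t. t \<in> {0..1} \<Longrightarrow> x (0, t) = 0"
      "\<And>s. s \<in> {0..1} \<Longrightarrow> x (s, 0) = 0 \<and> x (s, 1) = 0"
      "\<And>t. t \<in> {0..1} \<Longrightarrow> x (1, t) = Re (?r t)"
    by (rule circle_homotopy_lift[OF ch[of True], of "\<lambda>t. Re (?r t)"])
      (use hQ h(2-4) r0 in \<open>auto simp: norm_circle_retr circle_retr_point circle_retr_commutator_loop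
        intro!: continuous_intros cr\<close>)
  obtain y where y: "continuous_on ?Q y"
      "\<And>z. z \<in> ?Q \<Longrightarrow> circle_retr False (h z) = cis (2 * pi * y z)"
      "\<And>t. t \<in> {0..1} \<Longrightarrow> y (0, t) = 0"
      "\<And>s. s \<in> {0..1} \<Longrightarrow> y (s, 0) = 0 \<and> y (s, 1) = 0"
      "\<And>t. t \<in> {0..1} \<Longrightarrow> y (1, t) = Im (?r t)"
    by (rule circle_homotopy_lift[OF ch[of False], of "\<lambda>t. Im (?r t)"])
      (use hQ h(2-4) r0 in \<open>auto simp: norm_circle_retr circle_retr_point circle_retr_commutator_loop
        intro!: continuous_intros cr\<close>)
  define F where "F = (\<lambda>z. Complex (x z) (y z))"
  have half: "(1/2 :: real) \<notin> \<int>"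
  proof
    assume "(1/2 :: real) \<in> \<int>"
    then have "1 \<le> \<bar>1/2 :: real\<bar>"
      by (intro Ints_nonzero_abs_ge1) auto
    then show False
      by simp
  qed
  have "F z \<noteq> ?m" if z: "z \<in> ?Q" for z
  proof -
    have "x z \<in> \<int> \<or> y z \<in> \<int>"
      using circle_retr_eq_1_cases[OF hQ[OF z]] x(2)[OF z] y(2)[OF z]
      by (simp add: cis_two_pi_eq_1_iff)
    moreover have "x z = 1/2 \<and> y z = 1/2" if "F z = ?m"
      using that by (simp only: F_def complex.inject)
    ultimately show ?thesis
      using half by metis
  qed
  moreover have "continuous_on ?Q F"
    unfolding F_def Complex_eq by (intro continuous_intros x(1) y(1))
  moreover have "F (0, t) = 0" "F (t, 0) = 0" "F (t, 1) = 0" "F (1, t) = ?r t" if "t \<in> {0..1}" for t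
    using x(3-5)[OF that] y(3-5)[OF that] by (auto simp: F_def complex_eq_iff)
  ultimately have "homotopic_paths (- {?m}) (\<lambda>_. 0) ?r"
    unfolding homotopic_paths
    by (intro exI[of _ F]) (auto simp: pathstart_def pathfinish_def r0 o_def
        pathfinish_rectpath[unfolded pathfinish_def])
  then have "winding_number (\<lambda>_. 0) ?m = winding_number ?r ?m"
    by (rule winding_number_homotopic_paths)
  moreover have "winding_number (\<lambda>_. 0) ?m = 0"
    by (rule winding_number_zero_const) (simp add: complex_eq_iff)
  moreover have "winding_number ?r ?m = 1"
    by (rule winding_number_rectpath) (simp add: in_box_complex_iff)
  ultimately show False
    by simp
qed

theorem proposition3p19:
  shows "let X = product_topology (\<lambda>i::nat. two_circles) UNIV;
             x0 = (\<lambda>i::nat. two_circles_point);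
             \<pi> = fundamental_group X x0;
             W = whisker_topology X x0
         in topological_group \<pi> W
            \<and> \<not> comm_group \<pi>
            \<and> Hausdorff_space W
            \<and> W \<noteq> discrete_topology (carrier \<pi>)"
  unfolding Let_def
proof (intro conjI)
  let ?X = "product_topology (\<lambda>i::nat. two_circles) UNIV" and ?x0 = "\<lambda>i::nat. two_circles_point"
  note slsc = semilocally_simply_connected_at_two_circles
  show "topological_group (fundamental_group ?X ?x0) (whisker_topology ?X ?x0)"
    using slsc by (rule topological_group_whisker_topology_product)
  show "Hausdorff_space (whisker_topology ?X ?x0)"
    using slsc by (rule Hausdorff_space_whisker_topology_product)
  show "\<not> comm_group (fundamental_group ?X ?x0)"
    using two_circles_point_in_topspace
    by (intro fundamental_group_product_not_comm[of _ _ 0, OF _ loop_at_circle_loop loop_at_circle_loop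
          commutator_circle_loops_not_nullhomotopic]) auto
  show "whisker_topology ?X ?x0 \<noteq> discrete_topology (carrier (fundamental_group ?X ?x0))"
    using two_circles_point_in_topspace commutator_circle_loops_not_nullhomotopic
      loop_at_commutator_loop[OF loop_at_circle_loop loop_at_circle_loop]
    by (intro whisker_topology_product_not_discrete) auto
qed

end
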